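(* Let $c_0>0$ be a fixed universal constant that is admissible in the sense of the context. Fix $p\in(0,1)$. There are constants $C=C(p)<\infty$ and $n_*=n_*(p)<\infty$ such that, whenever an integer $n\ge n_*$ satisfies $$\mathbb P_p^{\mathrm M}\bigl(\mathrm{Cross}(100n,n)\bigr)\ge c_0,$$ then, for every $M\ge Cn^{10}$, $$\mathbb P_p^{\mathrm M}\bigl(B_n^{(M)}\bigr)\ge 1-C\exp\left\{-\frac{M}{Cn^{10}}\right\}.$$ Here $\mathbb P_p^{\mathrm M}$ is the Manhattan law (on $\mathbb Z^2$ for $\mathrm{Cross}$, on the cylinder $\mathcal C_n$ for $B_n^{(M)}$).
   Context: Lattices: $\mathbb Z^2$ with nearest-neighbor edges, and for an integer $n\ge1$ the cylinder $\mathcal C_n=\mathbb Z\times(\mathbb Z/2n\mathbb Z)$ (quotient of $\mathbb Z^2$ by translation by $(0,2n)$; its edges are the images of the edges of $\mathbb Z^2$). Mirrors and trajectories: each vertex has four incident half-edges $N,E,S,W$ (pointing in directions $(0,1),(1,0),(0,-1),(-1,0)$). A one-site state is one of: no mirror, pairing $(N,S)(E,W)$; a north-west (NW) mirror (a diagonal segment along the NW--SE direction), pairing $(N,E)(S,W)$; a north-east (NE) mirror (along the NE--SW direction), pairing $(N,W)(S,E)$. A ray arriving at a vertex along a half-edge leaves along the half-edge paired with it. A directed edge is an ordered pair $(u,v)$ of nearest neighbors along an edge; together with the environment (a state at each vertex) it determines a trajectory, i.e. the sequence of directed edges starting with $(u,v)$ and following this rule at each vertex; $u$ is its initial vertex.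 A trajectory segment is a finite sequence of consecutive directed edges $e_k=(v_{k-1},v_k)$ following the rule at each intermediate vertex. A trajectory remains in a set if all its vertices lie in it. Manhattan law $\mathbb P_p^{\mathrm M}$ (on $\mathbb Z^2$ or $\mathcal C_n$): independently at each vertex $(x,y)$, a mirror with probability $p$ and no mirror with probability $1-p$; a mirror at $(x,y)$ is NW if $x-y$ is even and NE otherwise (well defined on $\mathcal C_n$ since the circumference $2n$ is even). Lorentz mirror law $\mathbb P_p^{\mathrm L}$ (used here only in the definition of admissible): independently at each vertex, no mirror with probability $1-p$, and a NW or NE mirror with probability $p/2$ each. Crossing event (on $\mathbb Z^2$): for integers $m,h\ge1$ let $R_{m,h}=\{1,\dots,m\}\times\{1,\dots,h\}$. For $1\le i,j\le m$, $\mathrm{Cross}_{i,j}(m,h)$ is the event that there is a trajectory segment which enters $R_{m,h}$ through the directed edge $((i,0),(i,1))$, exits through $((j,h),(j,h+1))$, and has all intermediate vertices in $R_{m,h}$. $\mathrm{Cross}(m,h)=\bigcup_{1\le i,j\le m}\mathrm{Cross}_{i,j}(m,h)$. Localization event (on $\mathcal C_n$): for $M\ge1$, $B_n^{(M)}$ is the event that every trajectory whose initial vertex lies in $\{0\}\times(\mathbb Z/2n\mathbb Z)$ remains in $[-M,M]\times(\mathbb Z/2n\mathbb Z)$. Admissible constant: $c_0>0$ is a universal constant (independent of $p$, $n$, and the model), fixed once and for all and chosen small enough that the following holds: there are universal constants $c',C'>0$ such that for each of the two models, every $p\in(0,1)$ and every integer $n_0>100$ with $\mathbb P_p(\mathrm{Cross}(100n_0,n_0))\le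 c_0$, one has, for all $m\ge C'n_0$, that with probability at least $1-\exp\{-c'm/n_0\}$ every trajectory on $\mathbb Z^2$ with initial vertex in $[-1,1]^2$ remains in $[-m,m]^2$. *)

theory Defs
  imports "HOL-Probability.Probability"
begin

datatype dir = North | East | South | West

fun opposite :: "dir \<Rightarrow> dir" where
  "opposite North = South"
| "opposite South = North"
| "opposite East = West"
| "opposite West = East"

type_synonym vertex = "int \<times> int"

text \<open>
  \<open>Cylinder n\<close> is the quotient of the square lattice by the translation \<open>(0, 2 n)\<close>, for \<open>n \<ge> 1\<close>;
  its vertices are the representatives with second coordinate in \<open>{0..<2 n}\<close>.
\<close>

datatype lattice = Plane | Cylinder nat

fun verts :: "lattice \<Rightarrow> vertex set" where
  "verts Plane = UNIV"
| "verts (Cylinder n) = UNIV \<times> {0..<2 * int n}"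

fun representative :: "lattice \<Rightarrow> vertex \<Rightarrow> vertex" where
  "representative Plane v = v"
| "representative (Cylinder n) (x, y) = (x, y mod (2 * int n))"

fun shift :: "vertex \<Rightarrow> dir \<Rightarrow> vertex" where
  "shift (x, y) North = (x, y + 1)"
| "shift (x, y) East = (x + 1, y)"
| "shift (x, y) South = (x, y - 1)"
| "shift (x, y) West = (x - 1, y)"

definition neighbor :: "lattice \<Rightarrow> vertex \<Rightarrow> dir \<Rightarrow> vertex" where
  "neighbor L v d = representative L (shift v d)"

lemma neighbor_in_verts: "n \<ge> 1 \<Longrightarrow> neighbor (Cylinder n) v d \<in> verts (Cylinder n)"
  by (cases v; cases d) (auto simp: neighbor_def)

datatype site_state = No_Mirror | NW_Mirror | NE_Mirror

text \<open>The half-edge paired with a given half-edge; half-edges are named by their directions.\<close>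

fun paired :: "site_state \<Rightarrow> dir \<Rightarrow> dir" where
  "paired No_Mirror North = South"
| "paired No_Mirror South = North"
| "paired No_Mirror East = West"
| "paired No_Mirror West = East"
| "paired NW_Mirror North = East"
| "paired NW_Mirror East = North"
| "paired NW_Mirror South = West"
| "paired NW_Mirror West = South"
| "paired NE_Mirror North = West"
| "paired NE_Mirror West = North"
| "paired NE_Mirror South = East"
| "paired NE_Mirror East = South"

type_synonym environment = "vertex \<Rightarrow> site_state"

text \<open>
  The pair \<open>(u, d)\<close> stands for the directed edge from \<open>u\<close> to \<open>neighbor L u d\<close>. The direction is
  recorded instead of the end vertex because on \<open>Cylinder 1\<close> two edges join vertically adjacent
  vertices.
\<close>

type_synonym dedge = "vertex \<times> dir"

text \<open>A ray travelling in direction \<open>d\<close> arrives along the half-edge pointing in direction \<open>opposite d\<close>.\<close>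

fun next_edge :: "lattice \<Rightarrow> environment \<Rightarrow> dedge \<Rightarrow> dedge" where
  "next_edge L \<omega> (u, d) = (let v = neighbor L u d in (v, paired (\<omega> v) (opposite d)))"

definition trajectory :: "lattice \<Rightarrow> environment \<Rightarrow> dedge \<Rightarrow> nat \<Rightarrow> dedge" where
  "trajectory L \<omega> e k = (next_edge L \<omega> ^^ k) e"

text \<open>The end vertex of every edge of a trajectory is the initial vertex of the following one.\<close>

definition remains_in :: "lattice \<Rightarrow> environment \<Rightarrow> dedge \<Rightarrow> vertex set \<Rightarrow> bool" where
  "remains_in L \<omega> e A \<longleftrightarrow> (\<forall>k. fst (trajectory L \<omega> e k) \<in> A)"

definition all_remain_in :: "lattice \<Rightarrow> environment \<Rightarrow> vertex set \<Rightarrow> vertex set \<Rightarrow> bool" where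
  "all_remain_in L \<omega> S A \<longleftrightarrow> (\<forall>u\<in>S. \<forall>d. remains_in L \<omega> (u, d) A)"

definition trajectory_segment :: "lattice \<Rightarrow> environment \<Rightarrow> dedge list \<Rightarrow> bool" where
  "trajectory_segment L \<omega> es \<longleftrightarrow>
     es \<noteq> [] \<and> (\<forall>k. Suc k < length es \<longrightarrow> es ! Suc k = next_edge L \<omega> (es ! k))"

definition rectangle :: "int \<Rightarrow> int \<Rightarrow> vertex set" where
  "rectangle m h = {1..m} \<times> {1..h}"

text \<open>
  The intermediate vertices of a segment are the initial vertices of all its edges but the first.
\<close>

definition cross_from_to :: "int \<Rightarrow> int \<Rightarrow> int \<Rightarrow> int \<Rightarrow> environment \<Rightarrow> bool" where
  "cross_from_to i j m h \<omega> \<longleftrightarrow>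
     (\<exists>es. trajectory_segment Plane \<omega> es \<and>
           hd es = ((i, 0), North) \<and> last es = ((j, h), North) \<and>
           (\<forall>k. 0 < k \<and> k < length es \<longrightarrow> fst (es ! k) \<in> rectangle m h))"

definition cross :: "int \<Rightarrow> int \<Rightarrow> environment \<Rightarrow> bool" where
  "cross m h \<omega> \<longleftrightarrow> (\<exists>i\<in>{1..m}. \<exists>j\<in>{1..m}. cross_from_to i j m h \<omega>)"

definition localized :: "nat \<Rightarrow> real \<Rightarrow> environment \<Rightarrow> bool" where
  "localized n M \<omega> \<longleftrightarrow>
     all_remain_in (Cylinder n) \<omega>
       ({0} \<times> {0..<2 * int n})
       ({x. - M \<le> real_of_int x \<and> real_of_int x \<le> M} \<times> {0..<2 * int n})"

definition square :: "real \<Rightarrow> vertex set" where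
  "square m = {x. - m \<le> real_of_int x \<and> real_of_int x \<le> m} \<times>
              {y. - m \<le> real_of_int y \<and> real_of_int y \<le> m}"

datatype model = Manhattan | Lorentz

fun site_law :: "model \<Rightarrow> real \<Rightarrow> vertex \<Rightarrow> site_state pmf" where
  "site_law Manhattan p (x, y) =
     map_pmf (\<lambda>mirror. if mirror then (if even (x - y) then NW_Mirror else NE_Mirror) else No_Mirror)
       (bernoulli_pmf p)"
| "site_law Lorentz p (x, y) =
     bind_pmf (bernoulli_pmf p)
       (\<lambda>mirror. if mirror then pmf_of_set {NW_Mirror, NE_Mirror} else return_pmf No_Mirror)"

definition environment_law :: "model \<Rightarrow> lattice \<Rightarrow> real \<Rightarrow> environment measure" where
  "environment_law D L p = PiM (verts L) (\<lambda>v. measure_pmf (site_law D p v))"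

lemma prob_space_environment_law: "prob_space (environment_law D L p)"
  unfolding environment_law_def by (intro prob_space_PiM prob_space_measure_pmf)

definition admissible :: "real \<Rightarrow> bool" where
  "admissible c0 \<longleftrightarrow> c0 > 0 \<and>
     (\<exists>c' > 0. \<exists>C' > 0. \<forall>D p. \<forall>n0 :: nat.
        0 < p \<and> p < 1 \<and> n0 > 100 \<and>
        \<P>(\<omega> in environment_law D Plane p. cross (100 * int n0) (int n0) \<omega>) \<le> c0 \<longrightarrow>
        (\<forall>m :: real. m \<ge> C' * real n0 \<longrightarrow>
           \<P>(\<omega> in environment_law D Plane p. all_remain_in Plane \<omega> (square 1) (square m))
             \<ge> 1 - exp (- (c' * m / real n0))))"

end

theory Submission
  imports Defs
begin

text \<open>
  Cut the cylinder into consecutive blocks of \<open>100 n\<close> columns. The rays of the Manhattan model follow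
  one-way streets, so a slab has as many left-to-right as right-to-left crossing rays; call this
  number \<open>K\<close>. Adding a block never increases \<open>K\<close>, and \<open>K = 0\<close> makes the slab impassable.

  Some pair of columns \<open>i\<close>, \<open>j\<close> is joined by a vertical crossing with probability at least \<open>c n\<^sup>-\<^sup>2\<close>.
  Such a crossing of the lower half of a block and the reflection of another one in the upper half
  close up exactly, so a block contains a closed ray around the cylinder with probability at least
  \<open>c n\<^sup>-\<^sup>4\<close>. If \<open>K > 0\<close>, both a left-to-right ray and a right-to-left ray meet this ring. Toggling the
  mirror at a meeting point of the first with the ring merges the two; toggling the mirror at a
  meeting point with the second then turns both rays back, and \<open>K\<close> decreases. The choice of the two
  sites costs a factor \<open>C n\<^sup>4\<close>, so each block lowers \<open>K\<close> with probability at least \<open>c n\<^sup>-\<^sup>8\<close>, and the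
  expectation of \<open>2 ^ K\<close> on \<open>K > 0\<close> decays exponentially at the scale of \<open>n\<^sup>8\<close> blocks, which is \<open>n\<^sup>9\<close> columns.
  Since initially \<open>2 ^ K = 2 ^ n\<close>, a width of order \<open>n\<^sup>1\<^sup>0\<close> suffices.
\<close>

subsection \<open>Scattering systems\<close>

text \<open>The one-way streets make toggling tractable: exactly two street edges arrive at each
  vertex, and toggling the mirror there exchanges their continuations without reversing either ray.
  Two independent crossings fit together only if they use the same pair of columns, which is why one
  good pair is fixed beforehand. The sites to be toggled depend on the whole configuration, so the
  probability is transferred by a union bound over all choices of sites, not by conditioning on
  them. The weight \<open>2 ^ K\<close> is chosen because every decrease of \<open>K\<close> at
  least halves it, which gives a contraction by a factor that does not depend on \<open>K\<close>.
  The theorem also concerns trajectories that run against the streets; these are reversals of street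
  rays, and the balance between the two directions of crossing shows that a slab with
  \<open>K = 0\<close> stops them as well.\<close>

lemma funpow_agree_until:
  assumes "\<And>m. m < k \<Longrightarrow> F' ((F ^^ m) s) = F ((F ^^ m) s)"
  shows "(F' ^^ k) s = (F ^^ k) s"
  using assms by (induction k) auto

lemma funpow_mem:
  assumes "F ` A \<subseteq> A" "s \<in> A"
  shows "(F ^^ k) s \<in> A"
  using assms by (induction k) auto

lemma funpow_cancel:
  assumes "inj_on F A" "F ` A \<subseteq> A" "s \<in> A" "t \<in> A" "(F ^^ i) s = (F ^^ (i + k)) t"
  shows "s = (F ^^ k) t"
  using assms(5)
proof (induction i)
  case (Suc i)
  have "(F ^^ i) s \<in> A" "(F ^^ (i + k)) t \<in> A"
    using funpow_mem[OF assms(2,3)] funpow_mem[OF assms(2,4)] by blast+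
  with Suc show ?case
    using inj_onD[OF assms(1), of "(F ^^ i) s" "(F ^^ (i + k)) t"] by simp
qed simp

text \<open>
  A scattering system: rays enter at the sources \<open>In\<close> and \<open>Rin\<close> on the left and on the right,
  and end up in the absorbing sets \<open>L\<close> and \<open>R\<close> through the gates \<open>Lout\<close> and \<open>Rout\<close>.
\<close>

locale scattering =
  fixes F :: "'e \<Rightarrow> 'e" and E In Rin L R Lout Rout :: "'e set"
  assumes inj: "inj_on F E" and closed: "F ` E \<subseteq> E"
    and In_E: "In \<subseteq> E" and Rin_E: "Rin \<subseteq> E" and In_Rin: "In \<inter> Rin = {}"
    and source: "\<And>s m. s \<in> In \<union> Rin \<Longrightarrow> 0 < m \<Longrightarrow> (F ^^ m) s \<notin> In \<union> Rin"
    and abs_L: "F ` L \<subseteq> L" and abs_R: "F ` R \<subseteq> R" and L_R: "L \<inter> R = {}"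
    and reaches: "\<And>s. s \<in> In \<union> Rin \<Longrightarrow> \<exists>k. (F ^^ k) s \<in> L \<union> R"
    and gate_L: "\<And>s k. s \<in> In \<union> Rin \<Longrightarrow> (F ^^ k) s \<in> L \<Longrightarrow> \<exists>k. (F ^^ k) s \<in> Lout"
    and gate_R: "\<And>s k. s \<in> In \<union> Rin \<Longrightarrow> (F ^^ k) s \<in> R \<Longrightarrow> \<exists>k. (F ^^ k) s \<in> Rout"
    and fin: "finite Lout" "finite Rout" "finite In" "finite Rin"
    and card_L: "card Lout = card In" and card_R: "card Rout = card Rin"
begin

definition crossing :: "'e set" where
  "crossing = {s \<in> In. \<exists>k. (F ^^ k) s \<in> R}"

text \<open>By injectivity two rays that share an edge can be traced back together until one of them
  is at its source. The other is then at a source too, which can happen only at its own time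
  0.\<close>

lemma source_unique:
  assumes "s \<in> In \<union> Rin" "t \<in> In \<union> Rin" "(F ^^ i) s = (F ^^ j) t"
  shows "s = t \<and> i = j"
proof -
  have *: "s = t \<and> i = j" if "s \<in> In \<union> Rin" "t \<in> In \<union> Rin" "(F ^^ i) s = (F ^^ j) t" and le: "i \<le> j" for s t i j
  proof -
    obtain k where k: "j = i + k" using le by (auto simp: le_iff_add)
    have "s = (F ^^ k) t"
      using funpow_cancel[OF inj closed, of s t i k] that k In_E Rin_E by auto
    with source[OF that(2), of k] that k show ?thesis by (cases k) auto
  qed
  from *[OF assms] *[OF assms(2,1) assms(3)[symmetric]] show ?thesis
    by (cases "i \<le> j") auto
qed

lemma stays_L: "e \<in> L \<Longrightarrow> (F ^^ k) e \<in> L"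
  using funpow_mem[OF abs_L] .

lemma stays_R: "e \<in> R \<Longrightarrow> (F ^^ k) e \<in> R"
  using funpow_mem[OF abs_R] .

lemma stays_L': "(F ^^ i) e \<in> L \<Longrightarrow> i \<le> k \<Longrightarrow> (F ^^ k) e \<in> L"
  using stays_L[of "(F ^^ i) e" "k - i"] funpow_add[of "k - i" i F] by simp

lemma stays_R': "(F ^^ i) e \<in> R \<Longrightarrow> i \<le> k \<Longrightarrow> (F ^^ k) e \<in> R"
  using stays_R[of "(F ^^ i) e" "k - i"] funpow_add[of "k - i" i F] by simp

lemma not_both: "(F ^^ i) e \<in> L \<Longrightarrow> (F ^^ j) e \<in> R \<Longrightarrow> False"
  using stays_L'[of i e "max i j"] stays_R'[of j e "max i j"] L_R by auto

lemma too_many: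
  assumes "S \<subseteq> In \<union> Rin" "finite G" "card G < card S" "\<And>s. s \<in> S \<Longrightarrow> \<exists>k. (F ^^ k) s \<in> G"
  shows False
proof -
  obtain h where h: "\<And>s. s \<in> S \<Longrightarrow> (F ^^ h s) s \<in> G" using assms(4) by metis
  have "inj_on (\<lambda>s. (F ^^ h s) s) S"
  proof (rule inj_onI)
    fix s t assume "s \<in> S" "t \<in> S" "(F ^^ h s) s = (F ^^ h t) t"
    then show "s = t" using source_unique[of s t "h s" "h t"] assms(1) by blast
  qed
  moreover have "(\<lambda>s. (F ^^ h s) s) ` S \<subseteq> G" using h by auto
  ultimately show False
    using card_inj_on_le[OF _ _ assms(2)] assms(3) by (meson not_le)
qed

text \<open>Pigeonhole: if no ray from \<open>Rin\<close> went to \<open>L\<close>, all of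
  \<open>Rin\<close> and the crossing ray \<open>s\<close> would pass through \<open>Rout\<close>,
  which has only as many places as \<open>Rin\<close>, while distinct rays use distinct
  places.\<close>

lemma crossing_back:
  assumes "s \<in> crossing"
  obtains t k where "t \<in> Rin" "(F ^^ k) t \<in> L"
proof (rule ccontr)
  assume "\<not> thesis"
  with that have noback: "(F ^^ k) t \<notin> L" if "t \<in> Rin" for t k using that by blast
  have s: "s \<in> In" "s \<notin> Rin" "\<exists>k. (F ^^ k) s \<in> R" using assms In_Rin by (auto simp: crossing_def)
  have "\<exists>k. (F ^^ k) t \<in> Rout" if "t \<in> insert s Rin" for t
  proof -
    have "\<exists>k. (F ^^ k) t \<in> R"
    proof (cases "t = s")
      case False
      then have "t \<in> Rin" using that by simp
      then show ?thesis using reaches[of t] noback by blast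
    qed (use s in simp)
    then show ?thesis using gate_R[of t] that s by auto
  qed
  then show False
    using too_many[of "insert s Rin" Rout] fin s card_R by auto
qed

text \<open>The same count at \<open>Lout\<close>. It makes the absence of left-to-right crossings
  exclude right-to-left ones, so that a slab without crossings blocks both directions.\<close>

lemma back_crossing:
  assumes "t \<in> Rin" "(F ^^ k) t \<in> L"
  shows "crossing \<noteq> {}"
proof
  assume *: "crossing = {}"
  have t: "t \<in> Rin" "t \<notin> In" using assms In_Rin by auto
  have "\<exists>k. (F ^^ k) s \<in> Lout" if "s \<in> insert t In" for s
  proof -
    have "\<exists>k. (F ^^ k) s \<in> L"
      using that * assms reaches[of s] by (auto simp: crossing_def)
    then show ?thesis using gate_L[of s] that t by auto
  qed
  then show False
    using too_many[of "insert t In" Lout] fin t card_L by auto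
qed

text \<open>A ray from a source that met a periodic orbit would visit some edge at two different
  times.\<close>

lemma periodic_not_source:
  assumes "e \<in> E" "0 < m" "(F ^^ m) e = e" "s \<in> In \<union> Rin"
  shows "(F ^^ i) e \<noteq> (F ^^ j) s"
proof
  assume eq: "(F ^^ i) e = (F ^^ j) s"
  have "(F ^^ (m + j)) s = (F ^^ m) ((F ^^ i) e)" by (simp add: funpow_add eq)
  also have "\<dots> = (F ^^ i) ((F ^^ m) e)" by (simp flip: funpow_add[unfolded o_def, THEN fun_cong] add: add.commute)
  also have "\<dots> = (F ^^ j) s" by (simp add: assms eq)
  finally show False using source_unique[OF assms(4) assms(4)] assms(2) by fastforce
qed

end

section \<open>Exchanging the continuations of two edges\<close>

lemma swap_path:
  assumes F': "\<And>e. e \<in> E \<Longrightarrow> e \<noteq> e1 \<Longrightarrow> e \<noteq> e2 \<Longrightarrow> F' e = F e"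
    and "F ` E \<subseteq> E" "s \<in> E" "\<And>m. m < k \<Longrightarrow> (F ^^ m) s \<noteq> e1 \<and> (F ^^ m) s \<noteq> e2"
  shows "(F' ^^ k) s = (F ^^ k) s"
  using assms(4) by (intro funpow_agree_until F' funpow_mem[OF assms(2,3)]) auto

text \<open>Abstract form of toggling the mirror at a vertex: \<open>e1\<close> and
  \<open>e2\<close> are the two edges that arrive there, and the edge \<open>e1\<close> lies on the
  ray from \<open>s0\<close>.\<close>

locale swapped = scattering F E In Rin L R Lout Rout + swp: scattering F' E In Rin L R Lout Rout
  for F F' :: "'e \<Rightarrow> 'e" and E In Rin L R Lout Rout +
  fixes e1 e2 :: 'e and s0 :: 'e and i0 :: nat
  assumes F'1: "F' e1 = F e2" and F'2: "F' e2 = F e1" and e12: "e1 \<in> E" "e2 \<in> E"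
    and F'_other: "\<And>e. e \<in> E \<Longrightarrow> e \<noteq> e1 \<Longrightarrow> e \<noteq> e2 \<Longrightarrow> F' e = F e"
    and s0: "s0 \<in> In" and e1: "(F ^^ i0) s0 = e1"
begin

lemma same_path:
  assumes "s \<in> In \<union> Rin" "s \<noteq> s0" "\<And>m. (F ^^ m) s \<noteq> e2"
  shows "(F' ^^ k) s = (F ^^ k) s"
proof (rule swap_path[OF F'_other closed])
  show "s \<in> E" using assms In_E Rin_E by blast
  fix m show "(F ^^ m) s \<noteq> e1 \<and> (F ^^ m) s \<noteq> e2"
    using assms source_unique[of s s0 m i0] s0 e1 by auto
qed

lemma before:
  assumes "\<And>m. m < i0 \<Longrightarrow> (F ^^ m) s0 \<noteq> e2"
  shows "(F' ^^ i0) s0 = e1"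
proof -
  have "(F' ^^ i0) s0 = (F ^^ i0) s0"
  proof (rule swap_path[OF F'_other closed])
    show "s0 \<in> E" using s0 In_E by blast
    fix m assume "m < i0"
    then show "(F ^^ m) s0 \<noteq> e1 \<and> (F ^^ m) s0 \<noteq> e2"
      using assms[of m] source_unique[of s0 s0 m i0] s0 e1 by auto
  qed
  then show ?thesis by (simp add: e1)
qed

text \<open>Swapping a left-to-right ray with a right-to-left ray turns both into U-turns.\<close>

lemma swap_opposite:
  assumes "t0 \<in> Rin" "(F ^^ j0) t0 = e2" "(F ^^ l) t0 \<in> L" "s0 \<in> crossing"
  shows "swp.crossing = crossing - {s0}"
proof -
  have st: "(F ^^ i) s \<noteq> (F ^^ j) t0" if "s \<in> In" for i j s
    using source_unique[of s t0 i j] that assms(1) In_Rin by auto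
  have "s \<in> swp.crossing \<longleftrightarrow> s \<in> crossing" if "s \<noteq> s0" for s
  proof (cases "s \<in> In")
    case True
    have "(F' ^^ k) s = (F ^^ k) s" for k
      using same_path[of s] True that st[OF True] assms(2) by blast
    then show ?thesis by (simp add: crossing_def swp.crossing_def)
  qed (auto simp: crossing_def swp.crossing_def)
  moreover have "s0 \<notin> swp.crossing"
  proof
    assume "s0 \<in> swp.crossing"
    then obtain k where k: "(F' ^^ k) s0 \<in> R" by (auto simp: swp.crossing_def)
    have i0: "(F' ^^ i0) s0 = e1" using before st[OF s0, of _ j0] assms(2) by simp
    \<comment> \<open>After \<open>e1\<close> the new ray from \<open>s0\<close> follows the old ray
      of \<open>t0\<close> beyond \<open>e2\<close>. This tail avoids \<open>e1\<close>, which lies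
      on another ray, and \<open>e2\<close>, since a ray from a source repeats no edge; so
      \<open>F'\<close> acts on it like \<open>F\<close> and it ends in \<open>L\<close>.\<close>
    have "(F' ^^ r) ((F ^^ Suc j0) t0) = (F ^^ r) ((F ^^ Suc j0) t0)" for r
    proof (rule swap_path[OF F'_other closed])
      show "(F ^^ Suc j0) t0 \<in> E" using assms(1) Rin_E funpow_mem[OF closed] by blast
      fix m
      have "(F ^^ m) ((F ^^ Suc j0) t0) = (F ^^ (m + Suc j0)) t0" by (simp only: funpow_add o_apply)
      moreover have "(F ^^ (m + Suc j0)) t0 \<noteq> e1" using st[OF s0] e1 by metis
      moreover have "(F ^^ (m + Suc j0)) t0 \<noteq> e2"
        using source_unique[of t0 t0 "m + Suc j0" j0] assms(1,2) by auto
      ultimately show "(F ^^ m) ((F ^^ Suc j0) t0) \<noteq> e1 \<and> (F ^^ m) ((F ^^ Suc j0) t0) \<noteq> e2" by metis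
    qed
    moreover have "(F' ^^ Suc i0) s0 = (F ^^ Suc j0) t0" using i0 F'1 assms(2) by simp
    ultimately have "(F' ^^ (l + Suc i0)) s0 = (F ^^ l) ((F ^^ Suc j0) t0)"
      by (simp only: funpow_add o_apply)
    also have "\<dots> = (F ^^ (l + Suc j0)) t0" by (simp only: funpow_add o_apply)
    also have "\<dots> \<in> L" using stays_L'[OF assms(3), of "l + Suc j0"] by simp
    finally show False using swp.not_both k by blast
  qed
  ultimately show ?thesis by (intro set_eqI) (metis Diff_iff singletonD singletonI)
qed

text \<open>Swapping a left-to-right ray with a closed loop inserts the loop into the ray.\<close>

lemma swap_loop:
  assumes per: "0 < m" "(F ^^ m) e2 = e2" and "s0 \<in> crossing"
  shows "swp.crossing = crossing"
    and "t \<in> Rin \<Longrightarrow> (F' ^^ k) t = (F ^^ k) t"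
    and "\<exists>a. (F' ^^ a) s0 = (F ^^ r) e2"
proof -
  have st: "(F ^^ i) e2 \<noteq> (F ^^ j) s" if "s \<in> In \<union> Rin" for i j s
    using periodic_not_source[OF e12(2) per that] .
  have st0: "(F ^^ j) s \<noteq> e2" if "s \<in> In \<union> Rin" for j s
    using st[OF that, of 0] by (metis funpow_0)
  have other: "(F' ^^ k) s = (F ^^ k) s" if "s \<in> In \<union> Rin" "s \<noteq> s0" for s k
    using same_path[OF that] st0[OF that(1)] by blast
  show "t \<in> Rin \<Longrightarrow> (F' ^^ k) t = (F ^^ k) t" using other[of t k] s0 In_Rin by auto
  have i0: "(F' ^^ i0) s0 = e1" using before st0[of s0] s0 by blast
  \<comment> \<open>With the least period the loop is followed exactly once before \<open>e2\<close>
    recurs and the exchange takes effect again.\<close>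
  define q where "q = (LEAST q. 0 < q \<and> (F ^^ q) e2 = e2)"
  have q: "0 < q" "(F ^^ q) e2 = e2" and q_least: "\<And>r. 0 < r \<Longrightarrow> r < q \<Longrightarrow> (F ^^ r) e2 \<noteq> e2"
    using LeastI[of "\<lambda>q. 0 < q \<and> (F ^^ q) e2 = e2" m] per not_less_Least
    unfolding q_def by blast+
  have loop: "(F' ^^ (Suc r + i0)) s0 = (F ^^ Suc r) e2" if "r < q" for r
  proof -
    have "(F' ^^ r) (F e2) = (F ^^ r) (F e2)"
    proof (rule swap_path[OF F'_other closed])
      show "F e2 \<in> E" using e12 closed by auto
      fix m assume "m < r"
      then have "(F ^^ Suc m) e2 \<noteq> e2" using q_least[of "Suc m"] that by auto
      moreover have "(F ^^ Suc m) e2 \<noteq> e1" using st[of s0] s0 e1 by (metis UnI1)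
      ultimately show "(F ^^ m) (F e2) \<noteq> e1 \<and> (F ^^ m) (F e2) \<noteq> e2"
        by (simp add: funpow_swap1)
    qed
    moreover have "(F' ^^ (Suc r + i0)) s0 = (F' ^^ r) (F e2)"
      using i0 F'1 by (simp add: funpow_add funpow_swap1)
    ultimately show ?thesis by (simp add: funpow_swap1)
  qed
  show "\<exists>a. (F' ^^ a) s0 = (F ^^ r) e2"
  proof -
    have eq: "(F ^^ r) e2 = (F ^^ (r mod q)) e2" using funpow_mod_eq[OF q(2)] by metis
    show ?thesis
    proof (cases "r mod q")
      case 0
      then have "(F ^^ r) e2 = (F ^^ Suc (q - 1)) e2" using eq q by simp
      then show ?thesis using loop[of "q - 1"] q by (metis diff_less less_numeral_extra(1))
    next
      case (Suc r')
      then have "r' < q" using q(1) by (metis Suc_lessD mod_less_divisor)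
      then show ?thesis using loop[of r'] eq Suc by metis
    qed
  qed
  \<comment> \<open>After one turn the ray arrives at \<open>e2\<close>, whose new image is
    \<open>F e1\<close>. It resumes its old course there and still reaches \<open>R\<close>.\<close>
  have "(F' ^^ (q + i0)) s0 = e2" using loop[of "q - 1"] q by simp
  then have exit: "(F' ^^ Suc (q + i0)) s0 = F e1" by (simp add: F'2)
  have Fe1: "F e1 = (F ^^ Suc i0) s0" by (simp add: e1)
  have after: "(F' ^^ r) (F e1) = (F ^^ r) (F e1)" for r
  proof (rule swap_path[OF F'_other closed])
    show "F e1 \<in> E" using e12 closed by auto
    fix m
    have *: "(F ^^ m) (F e1) = (F ^^ (m + Suc i0)) s0" by (simp only: Fe1 funpow_add o_apply)
    moreover have "(F ^^ (m + Suc i0)) s0 \<noteq> e1"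
      using source_unique[of s0 s0 "m + Suc i0" i0] s0 e1 by auto
    moreover have "(F ^^ (m + Suc i0)) s0 \<noteq> e2" using st0 s0 by blast
    ultimately show "(F ^^ m) (F e1) \<noteq> e1 \<and> (F ^^ m) (F e1) \<noteq> e2" by metis
  qed
  obtain k where k: "(F ^^ k) s0 \<in> R" using assms(3) by (auto simp: crossing_def)
  have "(F' ^^ (k + Suc (q + i0))) s0 = (F' ^^ k) (F e1)"
    using exit by (simp only: funpow_add o_apply)
  also have "\<dots> = (F ^^ (k + Suc i0)) s0" unfolding after by (simp only: Fe1 funpow_add o_apply)
  also have "\<dots> \<in> R" using stays_R'[OF k, of "k + Suc i0"] by simp
  finally have "s0 \<in> swp.crossing" using s0 unfolding swp.crossing_def by blast
  moreover have "s \<in> swp.crossing \<longleftrightarrow> s \<in> crossing" if "s \<noteq> s0" for s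
    using other[of s] that by (auto simp: crossing_def swp.crossing_def)
  ultimately show "swp.crossing = crossing" using assms(3) by (intro set_eqI) metis
qed

end

subsection \<open>Rays on the cylinder\<close>

fun mirror_at :: "vertex \<Rightarrow> site_state" where
  "mirror_at (x, y) = (if even (x - y) then NW_Mirror else NE_Mirror)"

text \<open>The position of a site determines the type of its mirror, so a Manhattan environment is
  coded by the set of occupied sites and its randomness by independent coins.\<close>

definition mirrors :: "(vertex \<Rightarrow> bool) \<Rightarrow> environment" where
  "mirrors f v = (if f v then mirror_at v else No_Mirror)"

text \<open>
  With the mirrors of the Manhattan model a ray follows the one-way streets (rows alternately
  eastward and westward, columns alternately southward and northward), or their reversal, for ever.
\<close>

fun oriented :: "dedge \<Rightarrow> bool" where
  "oriented ((x, y), East) = even y"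
| "oriented ((x, y), West) = odd y"
| "oriented ((x, y), North) = odd x"
| "oriented ((x, y), South) = even x"

fun hdir :: "vertex \<Rightarrow> dir" where
  "hdir (x, y) = (if even y then East else West)"

fun vdir :: "vertex \<Rightarrow> dir" where
  "vdir (x, y) = (if even x then South else North)"

abbreviation head :: "nat \<Rightarrow> dedge \<Rightarrow> vertex" where
  "head n e \<equiv> neighbor (Cylinder n) (fst e) (snd e)"

abbreviation step :: "nat \<Rightarrow> (vertex \<Rightarrow> bool) \<Rightarrow> dedge \<Rightarrow> dedge" where
  "step n f \<equiv> next_edge (Cylinder n) (mirrors f)"

definition streets :: "nat \<Rightarrow> dedge set" where
  "streets n = {e. fst e \<in> verts (Cylinder n) \<and> oriented e}"

lemma UNIV_dir: "(UNIV :: dir set) = {North, East, South, West}"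
proof -
  have "d \<in> {North, East, South, West}" for d by (cases d) auto
  then show ?thesis by blast
qed

lemma finite_dir: "finite (A :: dir set)"
  using finite_subset[OF subset_UNIV, of A] by (simp add: UNIV_dir)

lemma even_mod_double: "even ((k :: int) mod (2 * m)) \<longleftrightarrow> even k"
  by (metis dvd_mod_iff dvd_triv_left)

lemma paired_paired [simp]: "paired s (paired s d) = d"
  by (cases s; cases d) auto

lemma opposite_opposite [simp]: "opposite (opposite d) = d"
  by (cases d) auto

lemma hdir_neq_vdir: "hdir v \<noteq> vdir v"
  by (cases v) auto

lemma head_in_verts: "n \<ge> 1 \<Longrightarrow> head n e \<in> verts (Cylinder n)"
  by (rule neighbor_in_verts)

lemma step_conv: "step n f e = (head n e, paired (mirrors f (head n e)) (opposite (snd e)))"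
  by (cases e) (simp add: Let_def)

lemma fst_step [simp]: "fst (step n f e) = head n e"
  by (simp add: step_conv)

lemma paired_No_Mirror: "paired No_Mirror (opposite d) = d"
  by (cases d) auto

lemma step_straight: "\<not> f (head n e) \<Longrightarrow> step n f e = (head n e, snd e)"
  by (simp add: step_conv mirrors_def paired_No_Mirror)

lemma street_dir:
  assumes "oriented e"
  shows "snd e \<in> {hdir (head n e), vdir (head n e)}"
  using assms by (cases e rule: oriented.cases) (auto simp: neighbor_def even_mod_double)

lemma oriented_dirs: "d \<in> {hdir v, vdir v} \<Longrightarrow> oriented (v, d)"
  by (cases v) (auto split: if_splits)

text \<open>A mirror exchanges the two streets through a vertex. The equation of truth values in the
  condition makes it visible that changing \<open>f w\<close> exchanges the two outcomes.\<close>

lemma turn: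
  assumes "d \<in> {hdir w, vdir w}"
  shows "paired (mirrors f w) (opposite d) = (if f w = (d = hdir w) then vdir w else hdir w)"
  using assms by (cases w) (auto simp: mirrors_def split: if_splits)

lemma step_street:
  assumes "oriented e"
  shows "step n f e = (head n e, if f (head n e) = (snd e = hdir (head n e))
           then vdir (head n e) else hdir (head n e))"
  using turn[OF street_dir[OF assms]] by (simp add: step_conv)

lemma step_closed: "n \<ge> 1 \<Longrightarrow> step n f ` streets n \<subseteq> streets n"
  using head_in_verts by (auto simp: streets_def step_street intro!: oriented_dirs)

lemma mod_shift_inj:
  fixes y y' c m :: int
  assumes "(y + c) mod m = (y' + c) mod m" "0 \<le> y" "y < m" "0 \<le> y'" "y' < m"
  shows "y = y'"
proof -
  have "y mod m = y' mod m" using assms(1) by (metis add_diff_cancel_right' mod_diff_left_eq)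
  then show ?thesis using assms by simp
qed

lemma neighbor_inj:
  assumes "neighbor (Cylinder n) u d = neighbor (Cylinder n) v d"
    and "u \<in> verts (Cylinder n)" "v \<in> verts (Cylinder n)"
  shows "u = v"
proof -
  obtain x y x' y' where uv: "u = (x, y)" "v = (x', y')" by (cases u, cases v) auto
  show ?thesis
    using assms mod_shift_inj[of y 1 "2 * int n" y'] mod_shift_inj[of y "-1" "2 * int n" y']
    by (cases d) (auto simp: uv neighbor_def)
qed

lemma step_inj: "inj_on (step n f) (streets n)"
proof (rule inj_onI)
  fix e e' assume e: "e \<in> streets n" "e' \<in> streets n" and eq: "step n f e = step n f e'"
  have h: "head n e = head n e'" using eq by (metis fst_step)
  have "(snd e = hdir (head n e)) = (snd e' = hdir (head n e))"
    using eq e hdir_neq_vdir[of "head n e"] by (auto simp: streets_def step_street h split: if_splits)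
  moreover have "snd e \<in> {hdir (head n e), vdir (head n e)}" "snd e' \<in> {hdir (head n e), vdir (head n e)}"
    using e street_dir[of e n] street_dir[of e' n] by (auto simp: streets_def h)
  ultimately have "snd e = snd e'" by auto
  with h have "fst e = fst e'"
    using neighbor_inj[of n "fst e" "snd e" "fst e'"] e by (auto simp: streets_def)
  with \<open>snd e = snd e'\<close> show "e = e'" by (simp add: prod_eq_iff)
qed

definition toggle :: "vertex \<Rightarrow> (vertex \<Rightarrow> bool) \<Rightarrow> vertex \<Rightarrow> bool" where
  "toggle w f = f(w := \<not> f w)"

lemma step_toggle_other: "head n e \<noteq> w \<Longrightarrow> step n (toggle w f) e = step n f e"
  by (simp add: step_conv toggle_def mirrors_def)

lemma step_toggle:
  assumes "e1 \<in> streets n" "e2 \<in> streets n" "e1 \<noteq> e2" "head n e1 = w" "head n e2 = w"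
  shows "step n (toggle w f) e1 = step n f e2"
proof -
  have "snd e1 \<noteq> snd e2"
    using assms neighbor_inj[of n "fst e1" "snd e1" "fst e2"] by (auto simp: streets_def prod_eq_iff)
  moreover have "snd e1 \<in> {hdir w, vdir w}" "snd e2 \<in> {hdir w, vdir w}"
    using assms street_dir[of e1 n] street_dir[of e2 n] by (auto simp: streets_def)
  ultimately show ?thesis
    using assms hdir_neq_vdir[of w] by (auto simp: streets_def step_street toggle_def)
qed

lemma head_col: "fst (head n e) = fst (fst e) + (case snd e of East \<Rightarrow> 1 | West \<Rightarrow> -1 | _ \<Rightarrow> 0)"
  by (cases e rule: oriented.cases) (auto simp: neighbor_def)

section \<open>Slabs, their ports and the scattering system that they form\<close>

definition rows :: "nat \<Rightarrow> int set" where
  "rows n = {0..<2 * int n}"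

lemma finite_rows [simp]: "finite {y \<in> rows n. P y}"
  by (rule finite_subset[of _ "{0..<2 * int n}"]) (auto simp: rows_def)

text \<open>The slab consists of the columns \<open>a + 1\<close> to \<open>b\<close>. Its ports are
  the street edges between columns \<open>a\<close> and \<open>a + 1\<close> and between
  \<open>b\<close> and \<open>b + 1\<close>; the parity of the row decides whether a port leads in
  or out.\<close>

definition enter_left :: "nat \<Rightarrow> int \<Rightarrow> dedge set" where
  "enter_left n a = (\<lambda>y. ((a, y), East)) ` {y \<in> rows n. even y}"

definition leave_left :: "nat \<Rightarrow> int \<Rightarrow> dedge set" where
  "leave_left n a = (\<lambda>y. ((a + 1, y), West)) ` {y \<in> rows n. odd y}"

definition enter_right :: "nat \<Rightarrow> int \<Rightarrow> dedge set" where
  "enter_right n b = (\<lambda>y. ((b + 1, y), West)) ` {y \<in> rows n. odd y}"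

definition leave_right :: "nat \<Rightarrow> int \<Rightarrow> dedge set" where
  "leave_right n b = (\<lambda>y. ((b, y), East)) ` {y \<in> rows n. even y}"

text \<open>The port edge itself belongs to \<open>gone_left\<close> and \<open>gone_right\<close>.
  Hence in an empty slab, \<open>a = b\<close>, every entering ray has already crossed, which
  permits an induction over blocks that starts with width 0.\<close>

definition gone_left :: "nat \<Rightarrow> int \<Rightarrow> dedge set" where
  "gone_left n a = {((x, y), West) |x y. x \<le> a + 1 \<and> y \<in> rows n \<and> odd y}"

definition gone_right :: "nat \<Rightarrow> int \<Rightarrow> dedge set" where
  "gone_right n b = {((x, y), East) |x y. b \<le> x \<and> y \<in> rows n \<and> even y}"

lemmas port_defs = enter_left_def leave_left_def enter_right_def leave_right_def
  gone_left_def gone_right_def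

definition supported :: "int \<Rightarrow> int \<Rightarrow> (vertex \<Rightarrow> bool) \<Rightarrow> bool" where
  "supported a b f \<longleftrightarrow> (\<forall>v. f v \<longrightarrow> a < fst v \<and> fst v \<le> b)"

lemma rows_verts: "(x, y) \<in> verts (Cylinder n) \<longleftrightarrow> y \<in> rows n"
  by (simp add: rows_def)

lemma card_parity_rows:
  "card {y \<in> rows n. even y} = n" "card {y \<in> rows n. odd y} = n"
proof -
  have "{y \<in> rows n. even y} = (\<lambda>k. 2 * int k) ` {..<n}"
  proof (intro set_eqI iffI)
    fix y assume y: "y \<in> {y \<in> rows n. even y}"
    then have "y = 2 * int (nat (y div 2))" "nat (y div 2) < n" by (auto simp: rows_def)
    then show "y \<in> (\<lambda>k. 2 * int k) ` {..<n}" by blast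
  qed (auto simp: rows_def)
  then show "card {y \<in> rows n. even y} = n" by (simp add: card_image inj_on_def)
  have "{y \<in> rows n. odd y} = (\<lambda>k. 2 * int k + 1) ` {..<n}"
  proof (intro set_eqI iffI)
    fix y assume y: "y \<in> {y \<in> rows n. odd y}"
    then have "y = 2 * int (nat (y div 2)) + 1" "nat (y div 2) < n" by (auto simp: rows_def)
    then show "y \<in> (\<lambda>k. 2 * int k + 1) ` {..<n}" by blast
  qed (auto simp: rows_def)
  then show "card {y \<in> rows n. odd y} = n" by (simp add: card_image inj_on_def)
qed

lemma neighbor_row:
  assumes "y \<in> rows n"
  shows "neighbor (Cylinder n) (x, y) East = (x + 1, y)" "neighbor (Cylinder n) (x, y) West = (x - 1, y)"
  using assms by (auto simp: neighbor_def rows_def)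

lemma finite_block: "finite {e :: dedge. a < fst (fst e) \<and> fst (fst e) \<le> b \<and> snd (fst e) \<in> rows n}"
  by (rule finite_subset[of _ "({a<..b} \<times> rows n) \<times> UNIV"]) (auto simp: rows_def finite_dir)

context
  fixes n :: nat and a b :: int and f :: "vertex \<Rightarrow> bool"
  assumes n: "n \<ge> 1" and ab: "a \<le> b" and f: "supported a b f"
begin

lemma no_mirror_outside: "x \<le> a \<or> b < x \<Longrightarrow> \<not> f (x, y)"
  using f by (auto simp: supported_def)

lemma gone_left_step: "step n f ` gone_left n a \<subseteq> gone_left n a"
  using no_mirror_outside by (auto simp: gone_left_def step_straight neighbor_row simp del: next_edge.simps)

lemma gone_right_step: "step n f ` gone_right n b \<subseteq> gone_right n b"
  using no_mirror_outside by (auto simp: gone_right_def step_straight neighbor_row simp del: next_edge.simps)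

text \<open>Edges that head for the slab and lie strictly before a port. A backward step from a port
  or from one of these edges leads to such an edge again, so a ray that started at a port cannot
  return to one.\<close>

private definition incoming :: "dedge set" where
  "incoming = {((x, y), East) |x y. x < a \<and> y \<in> rows n \<and> even y} \<union>
    {((x, y), West) |x y. b + 1 < x \<and> y \<in> rows n \<and> odd y}"

private lemma incoming_back:
  assumes "e \<in> streets n" "step n f e \<in> enter_left n a \<union> enter_right n b \<union> incoming"
  shows "e \<in> incoming"
proof -
  obtain x y d where se: "step n f e = ((x, y), d)" by (metis prod.exhaust)
  have x: "d = East \<and> x \<le> a \<or> d = West \<and> b < x"
    using assms(2) by (auto simp: se enter_left_def enter_right_def incoming_def)
  have h: "head n e = (x, y)" using se by (metis fst_conv fst_step)
  then have "step n f e = ((x, y), snd e)"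
    using step_straight[of f n e] no_mirror_outside[of x y] x by auto
  then have d: "snd e = d" using se by simp
  obtain x' y' where e: "e = ((x', y'), d)" using d by (metis prod.collapse)
  have "y' \<in> rows n" "oriented e" using assms(1) by (auto simp: e streets_def rows_def)
  then show ?thesis
    using x h by (auto simp: e neighbor_row incoming_def)
qed

private lemma no_return:
  assumes "s \<in> enter_left n a \<union> enter_right n b" "0 < m"
  shows "(step n f ^^ m) s \<notin> enter_left n a \<union> enter_right n b"
proof
  assume *: "(step n f ^^ m) s \<in> enter_left n a \<union> enter_right n b"
  have s: "s \<in> streets n" using assms(1) by (auto simp: enter_left_def enter_right_def streets_def rows_def)
  have "i < m \<Longrightarrow> (step n f ^^ (m - Suc i)) s \<in> incoming" for i
  proof (induction i)
    case 0
    then have "step n f ((step n f ^^ (m - 1)) s) = (step n f ^^ m) s"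
      by (metis Suc_diff_1 comp_apply funpow.simps(2))
    then show ?case
      using incoming_back[of "(step n f ^^ (m - 1)) s"] * funpow_mem[OF step_closed[OF n] s] by auto
  next
    case (Suc i)
    then have "step n f ((step n f ^^ (m - Suc (Suc i))) s) = (step n f ^^ (m - Suc i)) s"
      by (metis Suc_diff_Suc comp_apply funpow.simps(2))
    then show ?case
      using incoming_back[of "(step n f ^^ (m - Suc (Suc i))) s"] Suc
        funpow_mem[OF step_closed[OF n] s] by auto
  qed
  from this[of "m - 1"] assms have "s \<in> incoming" by simp
  with assms(1) show False by (auto simp: enter_left_def enter_right_def incoming_def)
qed

text \<open>A ray that never left would stay in a finite set and repeat an edge. By injectivity the
  repetition can be pulled back to the source, against \<open>no_return\<close>.\<close>

private lemma leaves:
  assumes s: "s \<in> enter_left n a \<union> enter_right n b"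
  shows "\<exists>k. (step n f ^^ k) s \<in> gone_left n a \<union> gone_right n b"
proof (rule ccontr)
  assume *: "\<not> ?thesis"
  have sE: "s \<in> streets n" using s by (auto simp: enter_left_def enter_right_def streets_def rows_def)
  let ?B = "{e :: dedge. a < fst (fst e) \<and> fst (fst e) \<le> b \<and> snd (fst e) \<in> rows n}"
  have "(step n f ^^ Suc k) s \<in> ?B" for k
  proof (induction k)
    case 0
    have "s \<notin> gone_left n a \<union> gone_right n b" using * by (metis funpow_0)
    moreover have "s \<in> gone_right n b" if "s \<in> enter_left n a" "b \<le> a"
      using that by (auto simp: port_defs)
    moreover have "s \<in> gone_left n a" if "s \<in> enter_right n b" "b \<le> a"
      using that by (auto simp: port_defs)
    ultimately have "a < b" using s by fastforce
    moreover have "fst (head n s) \<in> {a + 1, b}" "snd (head n s) \<in> rows n"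
      using s by (auto simp: enter_left_def enter_right_def neighbor_row)
    ultimately show ?case by (auto simp: step_conv)
  next
    case (Suc k)
    define e where "e = (step n f ^^ Suc k) s"
    have e: "e \<in> ?B" "e \<in> streets n" "e \<notin> gone_left n a \<union> gone_right n b"
      using Suc * funpow_mem[OF step_closed[OF n] sE] unfolding e_def by blast+
    obtain x y d where xyd: "e = ((x, y), d)" by (metis prod.exhaust)
    have out: "\<not> (d = West \<and> x \<le> a + 1)" "\<not> (d = East \<and> b \<le> x)"
      using e by (auto simp: xyd streets_def gone_left_def gone_right_def rows_def)
    have "a < fst (head n e) \<and> fst (head n e) \<le> b"
      using e(1) out head_col[of n e] by (cases d) (auto simp: xyd)
    moreover have "snd (head n e) \<in> rows n"
      using head_in_verts[OF n, of e] by (metis prod.collapse rows_verts)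
    ultimately have "step n f e \<in> ?B" by (simp del: next_edge.simps)
    then show ?case by (simp add: e_def del: next_edge.simps)
  qed
  then have "range (\<lambda>k. (step n f ^^ Suc k) s) \<subseteq> ?B" by blast
  then have "\<not> inj (\<lambda>k. (step n f ^^ Suc k) s)"
    using finite_subset[OF _ finite_block] range_inj_infinite by blast
  then obtain i j where ij: "i \<noteq> j" "(step n f ^^ Suc i) s = (step n f ^^ Suc j) s"
    unfolding inj_def by blast
  have *: False if "i < j" "(step n f ^^ Suc i) s = (step n f ^^ Suc j) s" for i j
  proof -
    have "s = (step n f ^^ (j - i)) s"
      using funpow_cancel[OF step_inj step_closed[OF n] sE sE, where i = "Suc i" and k = "j - i"] that
      by (simp del: next_edge.simps funpow.simps)
    then show False using no_return[OF s, of "j - i"] that s by simp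
  qed
  from ij(1) have "i < j \<or> j < i" by auto
  then show False using *[OF _ ij(2)] *[OF _ ij(2)[symmetric]] by blast
qed

text \<open>Outside the slab rays are straight, so an edge beyond the port has a predecessor that is
  also beyond the slab. The first such edge on a ray is therefore the port.\<close>

private lemma gates:
  assumes s: "s \<in> enter_left n a \<union> enter_right n b"
  shows "(step n f ^^ k) s \<in> gone_left n a \<Longrightarrow> \<exists>k. (step n f ^^ k) s \<in> leave_left n a"
    and "(step n f ^^ k) s \<in> gone_right n b \<Longrightarrow> \<exists>k. (step n f ^^ k) s \<in> leave_right n b"
proof -
  have sE: "s \<in> streets n" using s by (auto simp: enter_left_def enter_right_def streets_def rows_def)
  have *: "\<exists>k. (step n f ^^ k) s \<in> B"
    if "(step n f ^^ k) s \<in> A" "s \<in> A \<Longrightarrow> s \<in> B"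
      "\<And>e. e \<in> streets n \<Longrightarrow> e \<notin> A \<Longrightarrow> step n f e \<in> A \<Longrightarrow> step n f e \<in> B" for A B k
    using that(1)
  proof (induction k)
    case (Suc k)
    show ?case
    proof (cases "(step n f ^^ k) s \<in> A")
      case False
      then have "(step n f ^^ Suc k) s \<in> B"
        using that(3)[OF funpow_mem[OF step_closed[OF n] sE]] Suc.prems by (simp del: next_edge.simps)
      then show ?thesis by blast
    qed (use Suc.IH in blast)
  next
    case 0
    then have "(step n f ^^ 0) s \<in> B" using that(2) by simp
    then show ?case by blast
  qed
  have straight: "e = ((if d = East then x - 1 else x + 1, y), d)"
    if "e \<in> streets n" "step n f e = ((x, y), d)" "x \<le> a \<or> b < x" "d = East \<or> d = West" for e x y d
  proof -
    have h: "head n e = (x, y)" using that by (metis fst_conv fst_step)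
    then have "step n f e = ((x, y), snd e)"
      using step_straight[of f n e] no_mirror_outside[of x y] that(3) by simp
    then have d: "snd e = d" using that(2) by simp
    obtain x' y' where e: "e = ((x', y'), d)" using d by (metis prod.collapse)
    have "y' \<in> rows n" using that(1) by (auto simp: e streets_def rows_def)
    then show ?thesis using h that(4) by (auto simp: e neighbor_row)
  qed
  show "\<exists>k. (step n f ^^ k) s \<in> leave_left n a" if k: "(step n f ^^ k) s \<in> gone_left n a"
  proof (rule *[OF k])
    assume "s \<in> gone_left n a"
    then show "s \<in> leave_left n a" using s ab by (auto simp: port_defs)
  next
    fix e assume e: "e \<in> streets n" "e \<notin> gone_left n a" "step n f e \<in> gone_left n a"
    then obtain x y where xy: "step n f e = ((x, y), West)" "x \<le> a + 1" "y \<in> rows n" "odd y"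
      unfolding gone_left_def by blast
    have "\<not> x \<le> a"
    proof
      assume "x \<le> a"
      then have "e = ((x + 1, y), West)" using straight[OF e(1) xy(1)] by simp
      then show False using e(2) xy \<open>x \<le> a\<close> by (auto simp: gone_left_def)
    qed
    then show "step n f e \<in> leave_left n a" using xy by (auto simp: leave_left_def)
  qed
  show "\<exists>k. (step n f ^^ k) s \<in> leave_right n b" if k: "(step n f ^^ k) s \<in> gone_right n b"
  proof (rule *[OF k])
    assume "s \<in> gone_right n b"
    then show "s \<in> leave_right n b" using s ab by (auto simp: port_defs)
  next
    fix e assume e: "e \<in> streets n" "e \<notin> gone_right n b" "step n f e \<in> gone_right n b"
    then obtain x y where xy: "step n f e = ((x, y), East)" "b \<le> x" "y \<in> rows n" "even y"
      unfolding gone_right_def by blast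
    have "\<not> b < x"
    proof
      assume "b < x"
      then have "e = ((x - 1, y), East)" using straight[OF e(1) xy(1)] by simp
      then show False using e(2) xy \<open>b < x\<close> by (auto simp: gone_right_def)
    qed
    then show "step n f e \<in> leave_right n b" using xy by (auto simp: leave_right_def)
  qed
qed

text \<open>The balance of entrances and exits at each end holds because \<open>n\<close> rows lead
  east and \<open>n\<close> rows lead west.\<close>

lemma scattering_slab:
  "scattering (step n f) (streets n) (enter_left n a) (enter_right n b)
     (gone_left n a) (gone_right n b) (leave_left n a) (leave_right n b)"
proof
  show "inj_on (step n f) (streets n)" by (rule step_inj)
  show "step n f ` streets n \<subseteq> streets n" by (rule step_closed[OF n])
  show "enter_left n a \<subseteq> streets n" "enter_right n b \<subseteq> streets n"
    by (auto simp: enter_left_def enter_right_def streets_def rows_def)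
  show "enter_left n a \<inter> enter_right n b = {}" "gone_left n a \<inter> gone_right n b = {}"
    by (auto simp: port_defs)
  show "finite (leave_left n a)" "finite (leave_right n b)" "finite (enter_left n a)" "finite (enter_right n b)"
    by (simp_all add: port_defs)
  show "card (leave_left n a) = card (enter_left n a)" "card (leave_right n b) = card (enter_right n b)"
    by (simp_all add: port_defs card_image inj_on_def card_parity_rows)
  show "step n f ` gone_left n a \<subseteq> gone_left n a" "step n f ` gone_right n b \<subseteq> gone_right n b"
    by (rule gone_left_step gone_right_step)+
qed (fact no_return leaves gates)+

end

definition crossings :: "nat \<Rightarrow> int \<Rightarrow> int \<Rightarrow> (vertex \<Rightarrow> bool) \<Rightarrow> dedge set" where
  "crossings n a b f = {s \<in> enter_left n a. \<exists>k. (step n f ^^ k) s \<in> gone_right n b}"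

lemma crossings_scattering:
  assumes "scattering (step n f) (streets n) (enter_left n a) (enter_right n b)
     (gone_left n a) (gone_right n b) (leave_left n a) (leave_right n b)"
  shows "scattering.crossing (step n f) (enter_left n a) (gone_right n b) = crossings n a b f"
  by (simp add: scattering.crossing_def[OF assms] crossings_def)

lemma finite_crossings: "finite (crossings n a b f)"
  by (rule finite_subset[of _ "enter_left n a"]) (auto simp: crossings_def enter_left_def)

lemma card_crossings_le: "card (crossings n a b f) \<le> n"
proof -
  have "card (crossings n a b f) \<le> card (enter_left n a)"
    by (rule card_mono) (auto simp: crossings_def enter_left_def)
  then show ?thesis by (simp add: enter_left_def card_image inj_on_def card_parity_rows)
qed

subsection \<open>Rings and crossing rays\<close>

lemma enter_left_streets: "enter_left n a \<subseteq> streets n"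
  by (auto simp: enter_left_def streets_def rows_def)

text \<open>Follow a ray that crosses the longer slab up to its first step beyond column
  \<open>b\<close>: until then it has met only sites where \<open>h\<close> agrees with
  \<open>f\<close>, and it is then on the right port of the shorter slab.\<close>

lemma crossings_extend:
  assumes n: "n \<ge> 1" and "a \<le> b" "b \<le> c" and hf: "\<And>v. fst v \<le> b \<Longrightarrow> h v = f v"
  shows "crossings n a c h \<subseteq> crossings n a b f"
proof
  fix s assume "s \<in> crossings n a c h"
  then obtain k where s: "s \<in> enter_left n a" and k: "(step n h ^^ k) s \<in> gone_right n c"
    by (auto simp: crossings_def)
  let ?P = "\<lambda>k. b < fst (head n ((step n h ^^ k) s))"
  have "?P k" using k assms(3) by (auto simp: gone_right_def neighbor_row)
  then have P: "?P (LEAST k. ?P k)" and less: "\<And>m. m < (LEAST k. ?P k) \<Longrightarrow> \<not> ?P m"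
    by (rule LeastI) (rule not_less_Least)
  define K where "K = (LEAST k. ?P k)"
  define e where "e = (step n h ^^ K) s"
  have "(step n f ^^ K) s = (step n h ^^ K) s"
  proof (rule funpow_agree_until)
    fix m assume "m < K"
    then have "fst (head n ((step n h ^^ m) s)) \<le> b" using less[of m] by (simp add: K_def)
    then show "step n f ((step n h ^^ m) s) = step n h ((step n h ^^ m) s)"
      by (simp add: step_conv mirrors_def hf)
  qed
  moreover have "e \<in> gone_right n b"
  proof -
    have "fst (fst e) \<le> b"
    proof (cases K)
      case 0
      then show ?thesis using s assms(2) by (auto simp: e_def enter_left_def)
    next
      case (Suc m)
      then show ?thesis using less[of m] by (simp add: e_def K_def[symmetric] del: next_edge.simps)
    qed
    moreover have "b < fst (head n e)" using P by (simp add: e_def K_def)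
    moreover have "e \<in> streets n"
      unfolding e_def using funpow_mem[OF step_closed[OF n]] s enter_left_streets by blast
    ultimately show ?thesis using head_col[of n e]
      by (cases e rule: oriented.cases) (auto simp: gone_right_def streets_def rows_def)
  qed
  ultimately have "(step n f ^^ K) s \<in> gone_right n b" unfolding e_def by (simp only:)
  then show "s \<in> crossings n a b f" using s unfolding crossings_def by blast
qed

text \<open>
  Mod 2 the curve \<open>C\<close> is a flow without sources. The number of vertical edges of \<open>C\<close> to the left
  of a vertex can therefore change parity along a path only where the path meets \<open>C\<close>.
\<close>

locale parity_flow =
  fixes n :: nat and b c :: int and C :: "dedge set"
  assumes n: "n \<ge> 1"
    and deg: "\<And>v. v \<in> verts (Cylinder n) \<Longrightarrow>
      even (of_bool ((v, North) \<in> C) + of_bool ((v, East) \<in> C) +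
            of_bool ((v, South) \<in> C) + of_bool ((v, West) \<in> C) :: nat)"
    and rev: "\<And>v d. v \<in> verts (Cylinder n) \<Longrightarrow>
      (neighbor (Cylinder n) v d, opposite d) \<in> C \<longleftrightarrow> (v, d) \<in> C"
    and block: "\<And>v d. (v, d) \<in> C \<Longrightarrow> b < fst v \<and> fst v \<le> c"
begin

definition left_edges :: "int \<Rightarrow> int \<Rightarrow> int set" where
  "left_edges x y = {x'. x' < x \<and> ((x', y), North) \<in> C}"

abbreviation side :: "vertex \<Rightarrow> bool" where
  "side v \<equiv> odd (card (left_edges (fst v) (snd v)))"

lemma finite_left: "finite (left_edges x y)"
  by (rule finite_subset[of _ "{b<..c}"]) (use block in \<open>auto simp: left_edges_def\<close>)

lemma left_edges_Suc:
  "odd (card (left_edges (x + 1) y)) \<longleftrightarrow> (odd (card (left_edges x y)) \<noteq> (((x, y), North) \<in> C))"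
proof -
  have "left_edges (x + 1) y = (if ((x, y), North) \<in> C then insert x (left_edges x y) else left_edges x y)"
    using zless_add1_eq[of _ x] by (auto simp: left_edges_def)
  moreover have "x \<notin> left_edges x y" by (simp add: left_edges_def)
  ultimately show ?thesis using finite_left by simp
qed

text \<open>Induction over columns, starting to the left of \<open>C\<close>. Even degree at
  \<open>(x + 1, y')\<close> says that the vertical edges above and below it and the two horizontal
  edges cancel mod 2, so the horizontal edge carries the difference of the two counts.\<close>

lemma row_parity:
  assumes y: "y \<in> rows n" "y' = (y + 1) mod (2 * int n)"
  shows "(odd (card (left_edges (x + 1) y)) \<noteq> odd (card (left_edges (x + 1) y'))) \<longleftrightarrow> ((x, y'), East) \<in> C"
proof (cases "b \<le> x")
  case False
  have "left_edges (x + 1) z = {}" for z using False block[of "(_, z)" North] by (fastforce simp: left_edges_def)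
  moreover have "((x, y'), East) \<notin> C" using block[of "(x, y')" East] False by auto
  ultimately show ?thesis by simp
next
  case True
  then show ?thesis
  proof (induction x rule: int_ge_induct)
    case base
    have "left_edges (b + 1) z = {}" for z using block[of "(_, z)" North] by (fastforce simp: left_edges_def)
    moreover have "((b, y'), East) \<notin> C" using block[of "(b, y')" East] by auto
    ultimately show ?case by simp
  next
    case (step x)
    have y': "y' \<in> rows n" using y n by (simp add: rows_def)
    then have v: "(x + 1, y') \<in> verts (Cylinder n)" by (simp add: rows_def)
    have N: "((x + 1, y'), South) \<in> C \<longleftrightarrow> ((x + 1, y), North) \<in> C"
      using rev[of "(x + 1, y)" North] y by (simp add: neighbor_def rows_def)
    have W: "((x + 1, y'), West) \<in> C \<longleftrightarrow> ((x, y'), East) \<in> C"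
      using rev[of "(x, y')" East] y' by (simp add: neighbor_row) (simp add: rows_def)
    show ?case
      using deg[OF v] step.IH left_edges_Suc[of "x + 1" y] left_edges_Suc[of "x + 1" y']
      by (auto simp: N W split: if_splits)
  qed
qed

lemma side_left: "fst v \<le> b \<Longrightarrow> \<not> side v"
proof -
  assume "fst v \<le> b"
  then have "left_edges (fst v) (snd v) = {}"
    using block[of "(_, snd v)" North] by (fastforce simp: left_edges_def)
  then show ?thesis by simp
qed

text \<open>Beyond column \<open>c\<close> the count runs over a whole row. By
  \<open>row_parity\<close> its parity is the same for all rows, as no horizontal edge of
  \<open>C\<close> lies there.\<close>

lemma side_right:
  assumes r: "r \<in> rows n" "odd (card {x. ((x, r), North) \<in> C})"
    and v: "snd v \<in> rows n" "c < fst v"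
  shows "side v"
proof -
  have all: "left_edges x y = {x'. ((x', y), North) \<in> C}" if "c < x" for x y
    using that block[of "(_, y)" North] by (fastforce simp: left_edges_def)
  define T where "T y \<longleftrightarrow> odd (card {x'. ((x', y), North) \<in> C})" for y
  have next_row: "T ((y + 1) mod (2 * int n)) = T y" if "y \<in> rows n" for y
    using row_parity[OF that refl, of "c + 1"] block[of "(c + 1, _)" East]
    by (fastforce simp: all T_def)
  have "T (int k) = T 0" if "k < 2 * n" for k
    using that
  proof (induction k)
    case (Suc k)
    then have "(int k + 1) mod (2 * int n) = int (Suc k)" by simp
    then show ?case using Suc next_row[of "int k"] by (simp add: rows_def add.commute)
  qed simp
  then have "T y = T 0" if "y \<in> rows n" for y
    using that zero_le_imp_eq_int[of y] by (fastforce simp: rows_def)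
  then have "T (snd v) = T r" using v r by simp
  then show ?thesis using r v by (simp add: all T_def)
qed

lemma side_step:
  assumes v: "v \<in> verts (Cylinder n)" and w: "w = neighbor (Cylinder n) v d"
    and "\<And>d. (v, d) \<notin> C" "\<And>d. (w, d) \<notin> C"
  shows "side w = side v"
proof -
  have v_eq: "v = (fst v, snd v)" by simp
  have y: "snd v \<in> rows n" using v by (metis prod.collapse rows_verts)
  have w_v: "w \<in> verts (Cylinder n)" using w n neighbor_in_verts by blast
  then have y': "snd w \<in> rows n" by (metis prod.collapse rows_verts)
  \<comment> \<open>\<open>left_edges\<close> counts columns strictly to the left, so a vertical
    move is controlled by the horizontal edge that ends at the vertex from the west. If
    \<open>C\<close> misses the vertex, it misses this edge by \<open>rev\<close>.\<close>
  have west: "((fst u - 1, snd u), East) \<notin> C" if "u \<in> verts (Cylinder n)" "\<And>d. (u, d) \<notin> C" for u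
    using rev[of u West] that(1) that(2)[of West]
    by (cases u) (simp add: neighbor_row rows_verts del: verts.simps)
  show ?thesis
  proof (cases d)
    case East
    then have "w = (fst v + 1, snd v)" using w y neighbor_row(1)[of "snd v" n "fst v"] by simp
    then show ?thesis using left_edges_Suc[of "fst v" "snd v"] assms(3)[of North] by simp
  next
    case West
    then have *: "w = (fst v - 1, snd v)" using w y neighbor_row(2)[of "snd v" n "fst v"] by simp
    then show ?thesis using left_edges_Suc[of "fst v - 1" "snd v"] assms(4)[of North] by simp
  next
    case North
    then have *: "fst w = fst v" "snd w = (snd v + 1) mod (2 * int n)"
      using w by (cases v; simp add: neighbor_def)+
    show ?thesis
      using row_parity[OF y *(2), of "fst v - 1"] west[OF w_v assms(4)] * by simp
  next
    case South
    then have *: "fst w = fst v" "snd w = (snd v - 1) mod (2 * int n)"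
      using w by (cases v; simp add: neighbor_def)+
    have "snd v = (snd w + 1) mod (2 * int n)"
      using y unfolding * by (simp add: mod_add_left_eq rows_def)
    then show ?thesis
      using row_parity[OF y', of "snd v" "fst v - 1"] west[OF v assms(3)] * by simp
  qed
qed

lemma path_meets:
  assumes r: "r \<in> rows n" "odd (card {x. ((x, r), North) \<in> C})"
    and v: "\<And>i. v i \<in> verts (Cylinder n)" "\<And>i. v (Suc i) = neighbor (Cylinder n) (v i) (d i)"
    and ends: "fst (v 0) \<le> b \<and> c < fst (v k) \<or> c < fst (v 0) \<and> fst (v k) \<le> b"
  shows "\<exists>i d. (v i, d) \<in> C"
proof (rule ccontr)
  assume *: "\<not> ?thesis"
  have "side (v k) = side (v 0)" for k
    by (induction k) (use side_step[OF v(1) v(2)] * in auto)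
  moreover have "snd (v i) \<in> rows n" for i
    using v(1)[of i] by (metis prod.collapse rows_verts)
  ultimately show False
    using ends side_left side_right[OF r] by metis
qed

end

section \<open>Rings: closed rays that wind around the cylinder\<close>

definition reverse :: "nat \<Rightarrow> dedge \<Rightarrow> dedge" where
  "reverse n e = (head n e, opposite (snd e))"

text \<open>Adding the reversed edges turns the orbit into a set of undirected edges, as
  \<open>parity_flow\<close> requires.\<close>

definition ring :: "nat \<Rightarrow> (vertex \<Rightarrow> bool) \<Rightarrow> dedge \<Rightarrow> dedge set" where
  "ring n f e0 = range (\<lambda>k. (step n f ^^ k) e0) \<union> reverse n ` range (\<lambda>k. (step n f ^^ k) e0)"

text \<open>The last clause expresses winding around the cylinder mod 2: for some row, an odd number
  of undirected edges of the ring leads from it to the next row.\<close>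

definition closed_ring :: "nat \<Rightarrow> int \<Rightarrow> int \<Rightarrow> (vertex \<Rightarrow> bool) \<Rightarrow> dedge \<Rightarrow> bool" where
  "closed_ring n b c f e0 \<longleftrightarrow> e0 \<in> streets n \<and> (\<exists>m>0. (step n f ^^ m) e0 = e0) \<and>
     (\<forall>k. b < fst (fst ((step n f ^^ k) e0)) \<and> fst (fst ((step n f ^^ k) e0)) \<le> c) \<and>
     (\<exists>r\<in>rows n. odd (card {x. ((x, r), North) \<in> ring n f e0}))"

lemma neighbor_opposite:
  assumes "v \<in> verts (Cylinder n)"
  shows "neighbor (Cylinder n) (neighbor (Cylinder n) v d) (opposite d) = v"
  using assms by (cases v; cases d) (auto simp: neighbor_def mod_simps)

lemma reverse_reverse: "fst e \<in> verts (Cylinder n) \<Longrightarrow> reverse n (reverse n e) = e"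
  by (simp add: reverse_def neighbor_opposite)

text \<open>\<open>paired s\<close> is an involution without fixed points, so an invariant set of
  directions is a union of pairs.\<close>

lemma even_pairing:
  assumes "\<And>d. d \<in> D \<Longrightarrow> paired s d \<in> D"
  shows "even (of_bool (North \<in> D) + of_bool (East \<in> D) + of_bool (South \<in> D) + of_bool (West \<in> D) :: nat)"
proof -
  have "paired s d \<in> D \<longleftrightarrow> d \<in> D" for d using assms[of d] assms[of "paired s d"] by auto
  from this[of North] this[of East] this[of South] this[of West] show ?thesis
    by (cases s) auto
qed

lemma funpow_pred:
  assumes "0 < m" "(F ^^ m) e = e"
  shows "F ((F ^^ (i + (m - 1))) e) = (F ^^ i) e"
proof -
  have "F ((F ^^ (i + (m - 1))) e) = (F ^^ Suc (i + (m - 1))) e" by simp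
  also have "Suc (i + (m - 1)) = i + m" using assms(1) by simp
  also have "(F ^^ (i + m)) e = (F ^^ i) ((F ^^ m) e)" by (simp only: funpow_add o_apply)
  finally show ?thesis by (simp only: assms(2))
qed

text \<open>By periodicity every orbit edge has a predecessor on the orbit. Meetings with the ring
  are phrased through heads because toggling a mirror exchanges the edges that arrive at its
  site.\<close>

lemma ring_entry:
  assumes "closed_ring n b c f e0" "(w, d) \<in> ring n f e0"
  obtains k where "head n ((step n f ^^ k) e0) = w"
proof (cases "(w, d) \<in> range (\<lambda>k. (step n f ^^ k) e0)")
  case True
  then obtain k where "(w, d) = (step n f ^^ k) e0" by (rule rangeE)
  note k = this[symmetric]
  obtain m where m: "m > 0" "(step n f ^^ m) e0 = e0" using assms(1) unfolding closed_ring_def by blast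
  have "step n f ((step n f ^^ (k + (m - 1))) e0) = (w, d)" unfolding funpow_pred[OF m] by (rule k)
  from arg_cong[OF this, of fst] have "head n ((step n f ^^ (k + (m - 1))) e0) = w"
    by (simp only: fst_step fst_conv)
  then show thesis by (rule that)
next
  case False
  then have "(w, d) \<in> reverse n ` range (\<lambda>k. (step n f ^^ k) e0)" using assms(2) by (simp add: ring_def)
  then obtain k where "(w, d) = reverse n ((step n f ^^ k) e0)" by blast
  then have "head n ((step n f ^^ k) e0) = w" by (simp add: reverse_def)
  then show thesis by (rule that)
qed

text \<open>An arriving edge, reversed, and the departing edge that follows it are partners under
  the mirror. The half-edges of the ring at a vertex are thus invariant under the pairing, and the
  degree is even.\<close>

lemma ring_parity_flow:
  assumes n: "n \<ge> 1" and ring: "closed_ring n b c f e0"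
  shows "parity_flow n b c (ring n f e0)"
proof
  have E: "(step n f ^^ k) e0 \<in> streets n" for k
    using ring funpow_mem[OF step_closed[OF n]] unfolding closed_ring_def by blast
  then have V: "fst ((step n f ^^ k) e0) \<in> verts (Cylinder n)" for k
    by (auto simp: streets_def simp del: next_edge.simps verts.simps)
  have mem: "(step n f ^^ k) e0 \<in> ring n f e0" "reverse n ((step n f ^^ k) e0) \<in> ring n f e0" for k
    unfolding ring_def by blast+
  show "n \<ge> 1" by fact
  show "even (of_bool ((v, North) \<in> ring n f e0) + of_bool ((v, East) \<in> ring n f e0) +
      of_bool ((v, South) \<in> ring n f e0) + of_bool ((v, West) \<in> ring n f e0) :: nat)"
    for v
  proof -
    have "(v, paired (mirrors f v) d) \<in> ring n f e0" if d: "(v, d) \<in> ring n f e0" for d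
    proof -
      obtain k where k: "head n ((step n f ^^ k) e0) = v" using ring_entry[OF ring d] .
      show ?thesis
      proof (cases "(v, d) \<in> range (\<lambda>k. (step n f ^^ k) e0)")
        case True
        then obtain i where "(v, d) = (step n f ^^ i) e0" by (rule rangeE)
        note i = this[symmetric]
        obtain m where m: "m > 0" "(step n f ^^ m) e0 = e0" using ring unfolding closed_ring_def by blast
        define e where "e = (step n f ^^ (i + (m - 1))) e0"
        have *: "step n f e = (v, d)" unfolding e_def funpow_pred[OF m] by (rule i)
        have h: "head n e = v" using arg_cong[OF *, of fst] by (simp only: fst_step fst_conv)
        have "d = paired (mirrors f v) (opposite (snd e))"
          using arg_cong[OF *, of snd] by (simp only: step_conv snd_conv h)
        then have "(v, paired (mirrors f v) d) = reverse n e" by (simp add: reverse_def h)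
        then show ?thesis using mem by (simp add: e_def del: next_edge.simps)
      next
        case False
        then obtain i where i: "(v, d) = reverse n ((step n f ^^ i) e0)"
          using d unfolding ring_def by blast
        then have "(v, paired (mirrors f v) d) = (step n f ^^ Suc i) e0"
          by (simp add: reverse_def step_conv)
        then show ?thesis using mem(1)[of "Suc i"] by metis
      qed
    qed
    then show ?thesis
      using even_pairing[of "{d. (v, d) \<in> ring n f e0}" "mirrors f v"] by simp
  qed
  have rev: "reverse n e \<in> ring n f e0" if e: "e \<in> ring n f e0" for e
  proof (cases "e \<in> range (\<lambda>k. (step n f ^^ k) e0)")
    case True
    then obtain k where "e = (step n f ^^ k) e0" by (rule rangeE)
    then show ?thesis using mem(2) by metis
  next
    case False
    then obtain k where "e = reverse n ((step n f ^^ k) e0)" using e unfolding ring_def by blast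
    then show ?thesis using reverse_reverse[OF V] mem(1) by simp
  qed
  show "(neighbor (Cylinder n) v d, opposite d) \<in> ring n f e0 \<longleftrightarrow> (v, d) \<in> ring n f e0"
    if "v \<in> verts (Cylinder n)" for v d
    using rev[of "(v, d)"] rev[of "reverse n (v, d)"] reverse_reverse[of "(v, d)" n] that
    by (auto simp: reverse_def)
  show "b < fst v \<and> fst v \<le> c" if d: "(v, d) \<in> ring n f e0" for v d
  proof -
    obtain k where "head n ((step n f ^^ k) e0) = v" using ring_entry[OF ring d] .
    then have "fst ((step n f ^^ Suc k) e0) = v" by simp
    moreover have "b < fst (fst ((step n f ^^ Suc k) e0)) \<and> fst (fst ((step n f ^^ Suc k) e0)) \<le> c"
      using ring unfolding closed_ring_def by blast
    ultimately show ?thesis by simp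
  qed
qed

section \<open>Lowering the number of crossing rays by toggling\<close>

lemma street_unique:
  assumes "e \<in> streets n" "e' \<in> streets n" "head n e = head n e'" "snd e = snd e'"
  shows "e = e'"
proof (rule prod_eqI)
  show "fst e = fst e'"
    using neighbor_inj[of n "fst e" "snd e" "fst e'"] assms by (simp add: streets_def)
qed (fact assms(4))

text \<open>Only two street edges arrive at \<open>w\<close>, one horizontal and one vertical; these
  are \<open>e1\<close> and \<open>e2\<close>, and no other edge notices the toggle.\<close>

lemma swapped_toggle:
  assumes sc: "scattering (step n f) (streets n) In Rin L R Lout Rout"
    "scattering (step n (toggle w f)) (streets n) In Rin L R Lout Rout"
    and e1: "e1 \<in> streets n" "head n e1 = w" and e2: "e2 \<in> streets n" "head n e2 = w"
    and "e1 \<noteq> e2" "s0 \<in> In" "(step n f ^^ i0) s0 = e1"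
  shows "swapped (step n f) (step n (toggle w f)) (streets n) In Rin L R Lout Rout e1 e2 s0 i0"
proof (intro swapped.intro swapped_axioms.intro sc)
  show "step n (toggle w f) e1 = step n f e2" "step n (toggle w f) e2 = step n f e1"
    using step_toggle[of e1 n e2 w f] step_toggle[of e2 n e1 w f] e1 e2 \<open>e1 \<noteq> e2\<close> by simp_all
  show "step n (toggle w f) e = step n f e" if "e \<in> streets n" "e \<noteq> e1" "e \<noteq> e2" for e
  proof (cases "head n e = w")
    case True
    have "snd e1 \<in> {hdir w, vdir w}" "snd e2 \<in> {hdir w, vdir w}" "snd e \<in> {hdir w, vdir w}"
      using street_dir[of e1 n] street_dir[of e2 n] street_dir[of e n] that e1 e2 True
      by (auto simp: streets_def)
    then have "snd e = snd e1 \<or> snd e = snd e2 \<or> snd e1 = snd e2" by auto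
    moreover have "snd e1 \<noteq> snd e2" using street_unique[OF e1(1) e2(1)] e1 e2 \<open>e1 \<noteq> e2\<close> by metis
    ultimately have "snd e = snd e1 \<or> snd e = snd e2" by blast
    then have "e = e1 \<or> e = e2"
      using street_unique[OF that(1) e1(1)] street_unique[OF that(1) e2(1)] e1 e2 True by metis
    then show ?thesis using that by blast
  qed (rule step_toggle_other)
qed fact+

text \<open>The alternatives depend on whether a right-to-left ray \<open>t0\<close> arrives at the
  meeting point \<open>w1\<close> of \<open>s0\<close> with the ring. If it does, one toggle turns
  both rays back. If not, its own meeting point \<open>w2\<close> differs from \<open>w1\<close>,
  and the toggle at \<open>w1\<close> inserts the ring into the ray of \<open>s0\<close> but leaves
  the path of \<open>t0\<close> unchanged.\<close>

lemma crossings_drop: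
  assumes n: "n \<ge> 1" and abc: "a \<le> b" "b \<le> c" and f: "supported a c f"
    and ring: "closed_ring n b c f e0" and s0: "s0 \<in> crossings n a c f"
  obtains w1 where "w1 \<in> {b<..c} \<times> rows n" "crossings n a c (toggle w1 f) \<subset> crossings n a c f"
  | w1 w2 where "w1 \<in> {b<..c} \<times> rows n" "w2 \<in> {b<..c} \<times> rows n" "w1 \<noteq> w2"
      "crossings n a c (toggle w2 (toggle w1 f)) \<subset> crossings n a c f"
proof -
  define X where "X = (\<lambda>f. scattering (step n f) (streets n) (enter_left n a) (enter_right n c)
     (gone_left n a) (gone_right n c) (leave_left n a) (leave_right n c))"
  have X: "X f" if "supported a c f" for f
    unfolding X_def using scattering_slab[OF n _ that] abc by simp
  interpret sc: scattering "step n f" "streets n" "enter_left n a" "enter_right n c"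
     "gone_left n a" "gone_right n c" "leave_left n a" "leave_right n c"
    using X[OF f] unfolding X_def .
  interpret flow: parity_flow n b c "ring n f e0"
    using ring_parity_flow[OF n ring] .
  let ?F = "step n f"
  have cr: "sc.crossing = crossings n a c f" by (rule crossings_scattering) (fact X[OF f, unfolded X_def])
  have s0_in: "s0 \<in> enter_left n a" using s0 by (simp add: crossings_def)
  obtain k0 where k0: "(?F ^^ k0) s0 \<in> gone_right n c" using s0 by (auto simp: crossings_def)
  have s0_cr: "s0 \<in> sc.crossing" using s0 cr by simp
  obtain t0 l0 where t0: "t0 \<in> enter_right n c" and l0: "(?F ^^ l0) t0 \<in> gone_left n a"
    using sc.crossing_back[OF s0_cr] .
  have E: "(?F ^^ k) s \<in> streets n" if "s \<in> enter_left n a \<union> enter_right n c" for s k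
    using funpow_mem[OF sc.closed] that sc.In_E sc.Rin_E by blast
  obtain r where r: "r \<in> rows n" "odd (card {x. ((x, r), North) \<in> ring n f e0})"
    using ring unfolding closed_ring_def by blast
  have meet: "\<exists>i k. head n ((?F ^^ i) s) = head n ((?F ^^ k) e0)"
    if s: "s \<in> enter_left n a \<union> enter_right n c"
      and ends: "fst (fst s) \<le> b \<and> c < fst (fst ((?F ^^ k) s)) \<or> c < fst (fst s) \<and> fst (fst ((?F ^^ k) s)) \<le> b"
    for s k
  proof -
    have "\<exists>i d. (fst ((?F ^^ i) s), d) \<in> ring n f e0"
    proof (rule flow.path_meets[OF r])
      show "fst ((?F ^^ i) s) \<in> verts (Cylinder n)" for i using E[OF s, of i] unfolding streets_def by blast
      show "fst ((?F ^^ Suc i) s) = neighbor (Cylinder n) (fst ((?F ^^ i) s)) (snd ((?F ^^ i) s))" for i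
        by (simp del: next_edge.simps)
      show "fst (fst ((?F ^^ 0) s)) \<le> b \<and> c < fst (fst ((?F ^^ k) s)) \<or>
        c < fst (fst ((?F ^^ 0) s)) \<and> fst (fst ((?F ^^ k) s)) \<le> b"
        using ends by (simp del: next_edge.simps)
    qed
    then obtain i d where i: "(fst ((?F ^^ i) s), d) \<in> ring n f e0" by blast
    \<comment> \<open>The source lies outside the block, so the vertex of the meeting is the head of
      an edge of the ray.\<close>
    have "i \<noteq> 0"
    proof
      assume "i = 0"
      then show False using flow.block[OF i] ends by auto
    qed
    then obtain i' where "i = Suc i'" by (cases i) auto
    moreover obtain k where "head n ((?F ^^ k) e0) = fst ((?F ^^ i) s)" using ring_entry[OF ring i] .
    ultimately have "head n ((?F ^^ i') s) = head n ((?F ^^ k) e0)" by simp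
    then show ?thesis by blast
  qed
  obtain m where m: "m > 0" "(?F ^^ m) e0 = e0" and e0: "e0 \<in> streets n"
    using ring unfolding closed_ring_def by blast
  have periodic: "(?F ^^ m) ((?F ^^ k) e0) = (?F ^^ k) e0" for k
  proof -
    have "(?F ^^ m) ((?F ^^ k) e0) = (?F ^^ (m + k)) e0" by (simp only: funpow_add o_apply)
    also have "m + k = k + m" by simp
    also have "(?F ^^ (k + m)) e0 = (?F ^^ k) ((?F ^^ m) e0)" by (simp only: funpow_add o_apply)
    finally show ?thesis using m(2) by simp
  qed
  have e0_E: "(?F ^^ k) e0 \<in> streets n" for k using funpow_mem[OF sc.closed e0] .
  \<comment> \<open>\<open>gone_right\<close> begins in column \<open>c\<close> itself; one more
    step brings the ray beyond the block.\<close>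
  have "fst (fst ((?F ^^ Suc k0) s0)) > c"
    using k0 by (auto simp: gone_right_def neighbor_row simp del: next_edge.simps)
  then obtain i1 k1 where 1: "head n ((?F ^^ i1) s0) = head n ((?F ^^ k1) e0)"
    using meet[of s0 "Suc k0"] s0_in abc by (auto simp: enter_left_def simp del: next_edge.simps)
  have "fst (fst ((?F ^^ Suc l0) t0)) \<le> a"
    using l0 by (auto simp: gone_left_def neighbor_row simp del: next_edge.simps)
  then obtain i2 k2 where 2: "head n ((?F ^^ i2) t0) = head n ((?F ^^ k2) e0)"
    using meet[of t0 "Suc l0"] t0 abc by (auto simp: enter_right_def simp del: next_edge.simps)
  define w1 where "w1 = head n ((?F ^^ k1) e0)"
  define w2 where "w2 = head n ((?F ^^ k2) e0)"
  have block: "head n ((?F ^^ k) e0) \<in> {b<..c} \<times> rows n" for k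
  proof -
    have "fst ((?F ^^ Suc k) e0) = head n ((?F ^^ k) e0)" by simp
    then have "fst (head n ((?F ^^ k) e0)) \<in> {b<..c}"
      using ring unfolding closed_ring_def greaterThanAtMost_iff by metis
    moreover have "snd (head n ((?F ^^ k) e0)) \<in> rows n"
      using head_in_verts[OF n] by (metis prod.collapse rows_verts)
    ultimately show ?thesis by (simp add: mem_Times_iff del: next_edge.simps)
  qed
  have w: "w1 \<in> {b<..c} \<times> rows n" "w2 \<in> {b<..c} \<times> rows n" using block by (auto simp: w1_def w2_def simp del: next_edge.simps)
  have tog: "supported a c (toggle w g)" if "supported a c g" "w \<in> {b<..c} \<times> rows n" for w g
    using that abc by (auto simp: supported_def toggle_def)
  have X1: "X (toggle w1 f)" using X tog f w by blast
  interpret sc1: scattering "step n (toggle w1 f)" "streets n" "enter_left n a" "enter_right n c"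
     "gone_left n a" "gone_right n c" "leave_left n a" "leave_right n c"
    using X1 unfolding X_def .
  have cr1: "sc1.crossing = crossings n a c (toggle w1 f)"
    by (rule crossings_scattering) (fact X1[unfolded X_def])
  define e1 where "e1 = (?F ^^ i1) s0"
  have e1: "e1 \<in> streets n" "head n e1 = w1"
    using E s0_in 1 by (auto simp: e1_def w1_def simp del: next_edge.simps)
  show thesis
  proof (cases "\<exists>j. head n ((?F ^^ j) t0) = w1")
    case True
    then obtain j where j: "head n ((?F ^^ j) t0) = w1" by blast
    define e2 where "e2 = (?F ^^ j) t0"
    have e2: "e2 \<in> streets n" "head n e2 = w1" using E t0 j by (auto simp: e2_def simp del: next_edge.simps)
    have "e1 \<noteq> e2" using sc.source_unique[of s0 t0 i1 j] s0_in t0 sc.In_Rin by (auto simp: e1_def e2_def simp del: next_edge.simps)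
    interpret sw: swapped "step n f" "step n (toggle w1 f)" "streets n" "enter_left n a" "enter_right n c"
      "gone_left n a" "gone_right n c" "leave_left n a" "leave_right n c" e1 e2 s0 i1
      by (rule swapped_toggle[OF _ _ e1 e2 \<open>e1 \<noteq> e2\<close> s0_in e1_def[symmetric]])
        (fact X[OF f, unfolded X_def] X1[unfolded X_def])+
    have "crossings n a c (toggle w1 f) = crossings n a c f - {s0}"
      using sw.swap_opposite[OF t0 e2_def[symmetric] l0] s0 cr cr1 by simp
    then show thesis using that(1)[of w1] w s0 by blast
  next
    case False
    then have w12: "w1 \<noteq> w2" using 2 w2_def by metis
    define e2 where "e2 = (?F ^^ k1) e0"
    have e2: "e2 \<in> streets n" "head n e2 = w1"
      using e0_E by (auto simp: e2_def w1_def simp del: next_edge.simps)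
    have per: "(?F ^^ m) e2 = e2" unfolding e2_def by (rule periodic)
    have "e1 \<noteq> e2" using sc.periodic_not_source[OF e2(1) m(1) per, of s0 0 i1] s0_in by (auto simp: e1_def)
    interpret sw: swapped "step n f" "step n (toggle w1 f)" "streets n" "enter_left n a" "enter_right n c"
      "gone_left n a" "gone_right n c" "leave_left n a" "leave_right n c" e1 e2 s0 i1
      by (rule swapped_toggle[OF _ _ e1 e2 \<open>e1 \<noteq> e2\<close> s0_in e1_def[symmetric]])
        (fact X[OF f, unfolded X_def] X1[unfolded X_def])+
    note loop = sw.swap_loop[OF m(1) per]
    have s1: "crossings n a c (toggle w1 f) = crossings n a c f" using loop(1) s0 cr cr1 by simp
    have t_same: "(step n (toggle w1 f) ^^ k) t0 = (?F ^^ k) t0" for k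
      using loop(2) s0 cr t0 by simp
    define e3 where "e3 = (?F ^^ k2) e0"
    define e4 where "e4 = (?F ^^ i2) t0"
    have e3: "e3 \<in> streets n" "head n e3 = w2" using e0_E by (auto simp: e3_def w2_def simp del: next_edge.simps)
    have e4: "e4 \<in> streets n" "head n e4 = w2" using E t0 2 by (auto simp: e4_def w2_def simp del: next_edge.simps)
    have "\<exists>r. e3 = (?F ^^ r) e2"
    proof -
      \<comment> \<open>To reach \<open>e3\<close> from \<open>e2\<close> one would go back
        \<open>k1\<close> steps to \<open>e0\<close> and on by \<open>k2\<close>. Going forward by
        \<open>m * k1 - k1\<close> replaces the backward part, as \<open>m\<close> is a
        period.\<close>
      have "(?F ^^ (k2 + (m * k1 - k1))) e2 = (?F ^^ (k2 + (m * k1 - k1) + k1)) e0"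
        unfolding e2_def by (simp only: funpow_add o_apply)
      also have "k2 + (m * k1 - k1) + k1 = k2 + m * k1" using m(1) by (cases m) auto
      also have "(?F ^^ (k2 + m * k1)) e0 = (?F ^^ k2) ((?F ^^ (m * k1)) e0)" by (simp only: funpow_add o_apply)
      also have "(?F ^^ (m * k1)) e0 = e0"
        using funpow_mod_eq[OF m(2), of "m * k1"] by simp
      finally show ?thesis unfolding e3_def by metis
    qed
    then obtain i3 where i3: "(step n (toggle w1 f) ^^ i3) s0 = e3" using loop(3) s0 cr by metis
    have X2: "X (toggle w2 (toggle w1 f))" using X tog f w by blast
    interpret sc2: scattering "step n (toggle w2 (toggle w1 f))" "streets n" "enter_left n a" "enter_right n c"
       "gone_left n a" "gone_right n c" "leave_left n a" "leave_right n c"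
      using X2 unfolding X_def .
    have cr2: "sc2.crossing = crossings n a c (toggle w2 (toggle w1 f))"
      by (rule crossings_scattering) (fact X2[unfolded X_def])
    have "e3 \<noteq> e4"
      using sc1.source_unique[of s0 t0 i3 i2] s0_in t0 sc.In_Rin i3 t_same[of i2] by (auto simp: e4_def simp del: next_edge.simps)
    interpret sw2: swapped "step n (toggle w1 f)" "step n (toggle w2 (toggle w1 f))" "streets n" "enter_left n a" "enter_right n c"
      "gone_left n a" "gone_right n c" "leave_left n a" "leave_right n c" e3 e4 s0 i3
      by (rule swapped_toggle[OF _ _ e3 e4 \<open>e3 \<noteq> e4\<close> s0_in i3])
        (fact X1[unfolded X_def] X2[unfolded X_def])+
    have "crossings n a c (toggle w2 (toggle w1 f)) = crossings n a c (toggle w1 f) - {s0}"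
      using sw2.swap_opposite[OF t0, of i2 l0] t_same l0 s0 s1 cr1 cr2 by (simp add: e4_def del: next_edge.simps)
    then show thesis using that(2)[of w1 w2] w w12 s0 s1 by blast
  qed
qed

subsection \<open>Rings from vertical crossings\<close>

definition plane_reverse :: "dedge \<Rightarrow> dedge" where
  "plane_reverse e = (shift (fst e) (snd e), opposite (snd e))"

lemma plane_reverse_reverse [simp]: "plane_reverse (plane_reverse e) = e"
  by (cases e rule: oriented.cases) (auto simp: plane_reverse_def)

lemma plane_step: "next_edge Plane \<omega> e = (shift (fst e) (snd e), paired (\<omega> (shift (fst e) (snd e))) (opposite (snd e)))"
  by (cases e) (simp add: neighbor_def Let_def)

text \<open>A crossing as a set of undirected edges, closed under the mirror pairing inside the
  rectangle, with loose ends only below column \<open>i\<close> and above column \<open>j\<close>.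
  Directions are dropped because the reflected crossing runs against the one to which it is
  glued.\<close>

definition crossing_edges :: "int \<Rightarrow> int \<Rightarrow> int \<Rightarrow> int \<Rightarrow> environment \<Rightarrow> dedge set \<Rightarrow> bool" where
  "crossing_edges i j m h \<omega> P \<longleftrightarrow> finite P \<and> ((i, 0), North) \<in> P \<and> ((j, h), North) \<in> P \<and>
     (\<forall>e\<in>P. plane_reverse e \<in> P) \<and>
     (\<forall>v\<in>rectangle m h. \<forall>d. (v, d) \<in> P \<longrightarrow> (v, paired (\<omega> v) d) \<in> P) \<and>
     (\<forall>e\<in>P. fst e \<in> rectangle m h \<or> e = ((i, 0), North) \<or> e = ((j, h + 1), South))"

lemma crossing_edges_exist:
  assumes "cross_from_to i j m h \<omega>" "1 \<le> h"
  shows "\<exists>P. crossing_edges i j m h \<omega> P"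
proof -
  obtain es where seg: "trajectory_segment Plane \<omega> es" and hd: "hd es = ((i, 0), North)"
    and last: "last es = ((j, h), North)"
    and rect: "\<And>k. 0 < k \<Longrightarrow> k < length es \<Longrightarrow> fst (es ! k) \<in> rectangle m h"
    using assms(1) unfolding cross_from_to_def by blast
  have ne: "es \<noteq> []" and nxt: "\<And>k. Suc k < length es \<Longrightarrow> es ! Suc k = next_edge Plane \<omega> (es ! k)"
    using seg by (auto simp: trajectory_segment_def)
  have es0: "es ! 0 = ((i, 0), North)" and es_last: "es ! (length es - 1) = ((j, h), North)"
    using hd last ne by (simp_all add: hd_conv_nth last_conv_nth)
  define P where "P = set es \<union> plane_reverse ` set es"
  have mem: "es ! k \<in> P" "plane_reverse (es ! k) \<in> P" if "k < length es" for k
    using that by (auto simp: P_def)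
  have elim: "\<exists>k < length es. e = es ! k \<or> e = plane_reverse (es ! k)" if "e \<in> P" for e
    using that unfolding P_def by (metis UnE imageE in_set_conv_nth)
  have pair: "(v, paired (\<omega> v) d) \<in> P" if v: "v \<in> rectangle m h" and vd: "(v, d) \<in> P" for v d
  proof -
    obtain k where k: "k < length es" "(v, d) = es ! k \<or> (v, d) = plane_reverse (es ! k)"
      using elim[OF vd] by blast
    from k(2) show ?thesis
    proof
      assume eq: "(v, d) = es ! k"
      have "k \<noteq> 0"
      proof
        assume "k = 0"
        with eq es0 v show False by (simp add: rectangle_def)
      qed
      then obtain k' where k': "k = Suc k'" by (cases k) auto
      have "(v, d) = next_edge Plane \<omega> (es ! k')" using nxt[of k'] eq k k' by simp
      then have "(v, paired (\<omega> v) d) = plane_reverse (es ! k')"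
        by (simp add: plane_step plane_reverse_def)
      then show ?thesis using mem(2)[of k'] k k' by simp
    next
      assume eq: "(v, d) = plane_reverse (es ! k)"
      have "Suc k < length es"
      proof (rule ccontr)
        assume "\<not> Suc k < length es"
        then have "k = length es - 1" using k by simp
        then have "v = (j, h + 1)" using eq es_last by (simp add: plane_reverse_def)
        then show False using v by (simp add: rectangle_def)
      qed
      then have "es ! Suc k = (v, paired (\<omega> v) d)"
        using nxt[of k] eq by (simp add: plane_step plane_reverse_def)
      then show ?thesis using mem(1)[of "Suc k"] \<open>Suc k < length es\<close> by simp
    qed
  qed
  have tails: "fst e \<in> rectangle m h \<or> e = ((i, 0), North) \<or> e = ((j, h + 1), South)" if e: "e \<in> P" for e
  proof -
    obtain k where k: "k < length es" "e = es ! k \<or> e = plane_reverse (es ! k)"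
      using elim[OF e] by blast
    from k(2) show ?thesis
    proof
      assume "e = es ! k"
      then show ?thesis using rect[of k] k es0 by (cases "k = 0") auto
    next
      assume eq: "e = plane_reverse (es ! k)"
      show ?thesis
      proof (cases "Suc k < length es")
        case True
        have "fst e = fst (es ! Suc k)" using eq nxt[OF True] by (simp add: plane_step plane_reverse_def)
        then show ?thesis using rect[of "Suc k"] True by simp
      next
        case False
        then have "k = length es - 1" using k by simp
        then show ?thesis using eq es_last by (simp add: plane_reverse_def)
      qed
    qed
  qed
  have "plane_reverse e \<in> P" if "e \<in> P" for e
    using elim[OF that] mem by force
  moreover have "((i, 0), North) \<in> P" "((j, h), North) \<in> P"
    using mem(1)[of 0] mem(1)[of "length es - 1"] es0 es_last ne by simp_all
  moreover have "finite P" by (simp add: P_def)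
  ultimately show ?thesis unfolding crossing_edges_def using pair tails by blast
qed

fun flip :: "dir \<Rightarrow> dir" where
  "flip North = South"
| "flip South = North"
| "flip East = East"
| "flip West = West"

text \<open>
  The rectangle is copied into the lower half of a block and, reflected, into the upper half. For odd
  \<open>b\<close> the translation preserves the type of the mirror at a site and the reflection exchanges the types.
\<close>

definition lower :: "int \<Rightarrow> vertex \<Rightarrow> vertex" where
  "lower b v = (fst v + b, snd v - 1)"

definition upper :: "nat \<Rightarrow> int \<Rightarrow> vertex \<Rightarrow> vertex" where
  "upper n b v = (fst v + b, 2 * int n - snd v)"

text \<open>Modulo \<open>2 * n\<close>, each of the two maps sends rows 0 and \<open>n + 1\<close>
  to where the other sends rows 1 and \<open>n\<close>. In this way the loose ends of one copy enter
  the other copy.\<close>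

definition lower_edge :: "nat \<Rightarrow> int \<Rightarrow> dedge \<Rightarrow> dedge" where
  "lower_edge n b e = (representative (Cylinder n) (lower b (fst e)), snd e)"

definition upper_edge :: "nat \<Rightarrow> int \<Rightarrow> dedge \<Rightarrow> dedge" where
  "upper_edge n b e = (representative (Cylinder n) (upper n b (fst e)), flip (snd e))"

lemma reverse_lower_edge: "reverse n (lower_edge n b e) = lower_edge n b (plane_reverse e)"
  by (cases e rule: oriented.cases)
    (auto simp: reverse_def lower_edge_def plane_reverse_def lower_def neighbor_def mod_simps)

lemma reverse_upper_edge: "reverse n (upper_edge n b e) = upper_edge n b (plane_reverse e)"
  using mod_add_self2[of "1 - snd (fst e)" "int n * 2"] by (cases e rule: oriented.cases)
    (auto simp: reverse_def upper_edge_def plane_reverse_def upper_def neighbor_def mod_simps algebra_simps)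

lemma lower_rectangle:
  assumes "v \<in> rectangle m (int n)"
  shows "representative (Cylinder n) (lower b v) = lower b v"
  using assms by (cases v) (auto simp: rectangle_def lower_def)

lemma upper_rectangle:
  assumes "v \<in> rectangle m (int n)"
  shows "representative (Cylinder n) (upper n b v) = upper n b v"
  using assms by (cases v) (auto simp: rectangle_def upper_def simp del: minus_mod_self1)

lemma mirrors_lower:
  assumes "odd b" "g v = f (lower b v)"
  shows "paired (mirrors f (lower b v)) d = paired (mirrors g v) d"
  using assms by (cases v) (auto simp: mirrors_def lower_def)

lemma mirrors_upper:
  assumes "odd b" "g v = f (upper n b v)"
  shows "paired (mirrors f (upper n b v)) (flip d) = flip (paired (mirrors g v) d)"
  using assms by (cases v; cases d) (auto simp: mirrors_def upper_def)

text \<open>The glued set \<open>C\<close> is finite and invariant under \<open>step n f\<close>, so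
  a street orbit in it is periodic. Between the rows \<open>2 * n - 1\<close> and 0 it has a single
  edge, in column \<open>i + b\<close>; the orbit through this edge has an odd count there.\<close>

lemma ring_exists:
  assumes n: "n \<ge> 1" and b: "odd b" and ij: "i \<in> {1..m}" "j \<in> {1..m}"
    and cross: "cross_from_to i j m (int n) (mirrors g)" "cross_from_to i j m (int n) (mirrors g')"
    and g: "\<And>v. v \<in> rectangle m (int n) \<Longrightarrow> g v = f (lower b v)"
      "\<And>v. v \<in> rectangle m (int n) \<Longrightarrow> g' v = f (upper n b v)"
  shows "\<exists>e0. closed_ring n b (b + m) f e0"
proof -
  let ?R = "rectangle m (int n)"
  obtain P P' where P: "crossing_edges i j m (int n) (mirrors g) P"
    and P': "crossing_edges i j m (int n) (mirrors g') P'"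
    using crossing_edges_exist[OF cross(1)] crossing_edges_exist[OF cross(2)] n by auto
  have mem: "((i, 0), North) \<in> P" "((i, 1), South) \<in> P" "((j, int n), North) \<in> P" "((j, int n + 1), South) \<in> P"
    if "crossing_edges i j m (int n) \<omega> P" for \<omega> P
    using that unfolding crossing_edges_def by (force simp: plane_reverse_def)+
  define C where "C = lower_edge n b ` P \<union> upper_edge n b ` P'"
  have fin: "finite C" using P P' by (simp add: C_def crossing_edges_def)
  have rev: "reverse n e \<in> C" if "e \<in> C" for e
    using that P P' unfolding C_def crossing_edges_def
    by (auto simp: reverse_lower_edge reverse_upper_edge)
  have low: "(v, paired (mirrors f v) d) \<in> C" if "(v0, d) \<in> P" "v0 \<in> ?R" "v = lower b v0" for v v0 d
  proof -
    have "(v0, paired (mirrors g v0) d) \<in> P" using P that unfolding crossing_edges_def by blast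
    then have "lower_edge n b (v0, paired (mirrors g v0) d) \<in> C" by (simp add: C_def)
    then show ?thesis
      using that mirrors_lower[of b g v0 f d, OF b g(1)[OF that(2)]] lower_rectangle[of v0 m n b] by (simp add: lower_edge_def)
  qed
  have upp: "(v, paired (mirrors f v) (flip d)) \<in> C" if "(v0, d) \<in> P'" "v0 \<in> ?R" "v = upper n b v0" for v v0 d
  proof -
    have "(v0, paired (mirrors g' v0) d) \<in> P'" using P' that unfolding crossing_edges_def by blast
    then have "upper_edge n b (v0, paired (mirrors g' v0) d) \<in> C" by (simp add: C_def)
    then show ?thesis
      using that mirrors_upper[of b g' v0 f n d, OF b g(2)[OF that(2)]] upper_rectangle[of v0 m n b] by (simp add: upper_edge_def)
  qed
  have in_R: "(i, 1) \<in> ?R" "(j, int n) \<in> ?R" using ij n by (auto simp: rectangle_def)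
  have pair: "(v, paired (mirrors f v) d) \<in> C" if vd: "(v, d) \<in> C" for v d
    using vd unfolding C_def
  proof
    assume "(v, d) \<in> lower_edge n b ` P"
    then obtain v0 where v0: "(v0, d) \<in> P" "v = representative (Cylinder n) (lower b v0)"
      by (auto simp: lower_edge_def)
    consider "v0 \<in> ?R" | "v0 = (i, 0)" "d = North" | "v0 = (j, int n + 1)" "d = South"
      using P v0(1) unfolding crossing_edges_def by fastforce
    then show "(v, paired (mirrors f v) d) \<in> lower_edge n b ` P \<union> upper_edge n b ` P'"
      unfolding C_def[symmetric]
    proof cases
      case 1
      then show "(v, paired (mirrors f v) d) \<in> C" using low[OF v0(1)] v0(2) lower_rectangle by metis
    next
      case 2
      then have "v = upper n b (i, 1)" using v0(2) n by (simp add: lower_def upper_def zmod_minus1)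
      then show "(v, paired (mirrors f v) d) \<in> C" using upp[OF mem(2)[OF P'] in_R(1)] 2 by simp
    next
      case 3
      then have "v = upper n b (j, int n)" using v0(2) n by (simp add: lower_def upper_def)
      then show "(v, paired (mirrors f v) d) \<in> C" using upp[OF mem(3)[OF P'] in_R(2)] 3 by simp
    qed
  next
    assume "(v, d) \<in> upper_edge n b ` P'"
    then obtain v0 d0 where v0: "(v0, d0) \<in> P'" "v = representative (Cylinder n) (upper n b v0)" "d = flip d0"
      by (auto simp: upper_edge_def)
    consider "v0 \<in> ?R" | "v0 = (i, 0)" "d0 = North" | "v0 = (j, int n + 1)" "d0 = South"
      using P' v0(1) unfolding crossing_edges_def by fastforce
    then show "(v, paired (mirrors f v) d) \<in> lower_edge n b ` P \<union> upper_edge n b ` P'"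
      unfolding C_def[symmetric]
    proof cases
      case 1
      then show "(v, paired (mirrors f v) d) \<in> C" using upp[OF v0(1)] v0(2,3) upper_rectangle by metis
    next
      case 2
      then have "v = lower b (i, 1)" using v0(2) n by (simp add: lower_def upper_def)
      then show "(v, paired (mirrors f v) d) \<in> C" using low[OF mem(2)[OF P] in_R(1)] v0 2 by simp
    next
      case 3
      then have "v = lower b (j, int n)" using v0(2) n by (simp add: lower_def upper_def)
      then show "(v, paired (mirrors f v) d) \<in> C" using low[OF mem(3)[OF P] in_R(2)] v0 3 by simp
    qed
  qed
  have step_C: "step n f ` C \<subseteq> C"
  proof (intro subsetI, elim imageE)
    fix e e' assume "e \<in> C" "e' = step n f e"
    then show "e' \<in> C" using rev[of e] pair[of "head n e" "opposite (snd e)"]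
      by (simp add: step_conv reverse_def)
  qed
  have cols: "b < fst (fst e) \<and> fst (fst e) \<le> b + m" if "e \<in> C" for e
    using that unfolding C_def
  proof
    assume "e \<in> lower_edge n b ` P"
    then obtain e' where e': "e' \<in> P" "fst (fst e) = fst (fst e') + b"
      by (auto simp: lower_edge_def lower_def)
    then have "fst e' \<in> ?R \<or> e' = ((i, 0), North) \<or> e' = ((j, int n + 1), South)"
      using P unfolding crossing_edges_def by blast
    then show ?thesis using ij e'(2) by (auto simp: rectangle_def)
  next
    assume "e \<in> upper_edge n b ` P'"
    then obtain e' where e': "e' \<in> P'" "fst (fst e) = fst (fst e') + b"
      by (auto simp: upper_edge_def upper_def)
    then have "fst e' \<in> ?R \<or> e' = ((i, 0), North) \<or> e' = ((j, int n + 1), South)"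
      using P' unfolding crossing_edges_def by blast
    then show ?thesis using ij e'(2) by (auto simp: rectangle_def)
  qed
  let ?r = "2 * int n - 1"
  let ?z = "((i + b, ?r), North)"
  have level: "((x, ?r), North) \<in> C \<longleftrightarrow> x = i + b" for x
  proof
    assume "((x, ?r), North) \<in> C"
    then show "x = i + b" unfolding C_def
    proof
      assume "((x, ?r), North) \<in> lower_edge n b ` P"
      then obtain v0 where v0: "(v0, North) \<in> P" "(x, ?r) = representative (Cylinder n) (lower b v0)"
        by (auto simp: lower_edge_def)
      have "v0 \<notin> ?R"
      proof
        assume "v0 \<in> ?R"
        then have "(x, ?r) = lower b v0" using v0(2) lower_rectangle by metis
        with \<open>v0 \<in> ?R\<close> show False by (auto simp: rectangle_def lower_def)
      qed
      then have "v0 = (i, 0)" using P v0(1) unfolding crossing_edges_def by fastforce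
      then show "x = i + b" using v0(2) by (simp add: lower_def)
    next
      assume "((x, ?r), North) \<in> upper_edge n b ` P'"
      then obtain e0 where e0: "e0 \<in> P'" "(x, ?r) = representative (Cylinder n) (upper n b (fst e0))" "flip (snd e0) = North"
        by (auto simp: upper_edge_def)
      have S: "snd e0 = South" using e0(3) by (cases "snd e0") auto
      have "fst e0 \<in> ?R"
      proof (rule ccontr)
        assume "fst e0 \<notin> ?R"
        then have "e0 = ((j, int n + 1), South)"
          using P' e0(1) S unfolding crossing_edges_def by fastforce
        then show False using e0(2) n by (auto simp: upper_def)
      qed
      then have "(x, ?r) = upper n b (fst e0)" using e0(2) upper_rectangle by metis
      \<comment> \<open>The edge leads down out of row 1 of the rectangle, so its reversal starts
        below the rectangle and can only be the entrance in column \<open>i\<close>.\<close>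
      then have "fst e0 = (x - b, 1)" by (auto simp: upper_def prod_eq_iff)
      then have "plane_reverse e0 = ((x - b, 0), North)" using S by (simp add: plane_reverse_def)
      moreover have "plane_reverse e0 \<in> P'" using P' e0(1) unfolding crossing_edges_def by blast
      ultimately have "((x - b, 0), North) = ((i, 0), North)"
        using P' unfolding crossing_edges_def by (force simp: rectangle_def)
      then show "x = i + b" by simp
    qed
  next
    assume "x = i + b"
    then have "((x, ?r), North) = lower_edge n b ((i, 0), North)"
      using n by (simp add: lower_edge_def lower_def zmod_minus1)
    then show "((x, ?r), North) \<in> C" using mem(1)[OF P] by (simp add: C_def)
  qed
  have z: "?z \<in> C" using level by simp
  have z_verts: "fst ?z \<in> verts (Cylinder n)" using n by simp
  \<comment> \<open>One of the two directions of the seam edge follows the streets, whichever parity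
    column \<open>i + b\<close> has.\<close>
  obtain e0 where e0: "e0 \<in> {?z, reverse n ?z}" "oriented e0"
  proof (cases "oriented ?z")
    case False
    then have "oriented (reverse n ?z)" using n by (simp add: reverse_def neighbor_def)
    then show thesis using that by blast
  qed (use that in blast)
  have e0_C: "e0 \<in> C" using e0 z rev by blast
  have e0_streets: "e0 \<in> streets n"
  proof -
    have "fst e0 = fst ?z \<or> fst e0 = head n ?z" using e0(1) by (auto simp: reverse_def)
    then have "fst e0 \<in> verts (Cylinder n)" using z_verts head_in_verts[OF n, of ?z] by metis
    then show ?thesis using e0(2) unfolding streets_def by blast
  qed
  have orbit: "(step n f ^^ k) e0 \<in> C" for k using funpow_mem[OF step_C e0_C] .
  have "\<not> inj (\<lambda>k. (step n f ^^ k) e0)"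
  proof
    assume "inj (\<lambda>k. (step n f ^^ k) e0)"
    moreover have "range (\<lambda>k. (step n f ^^ k) e0) \<subseteq> C" by (intro image_subsetI orbit)
    ultimately show False using range_inj_infinite finite_subset[OF _ fin] by metis
  qed
  then obtain k l where kl: "k \<noteq> l" "(step n f ^^ k) e0 = (step n f ^^ l) e0"
    unfolding inj_def by blast
  have per: "\<exists>q>0. (step n f ^^ q) e0 = e0" if "k < l" "(step n f ^^ k) e0 = (step n f ^^ l) e0" for k l
    using funpow_cancel[OF step_inj step_closed[OF n] e0_streets e0_streets, where i = k and k = "l - k"] that
    by (intro exI[of _ "l - k"]) (simp del: next_edge.simps)
  have "\<exists>q>0. (step n f ^^ q) e0 = e0"
    using per[of k l] per[of l k] kl by (cases "k < l") auto
  moreover have "ring n f e0 \<subseteq> C" using orbit rev unfolding ring_def by blast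
  moreover have "?z \<in> ring n f e0"
  proof -
    have "e0 \<in> range (\<lambda>k. (step n f ^^ k) e0)" by (rule range_eqI[of _ _ 0]) simp
    then have "e0 \<in> ring n f e0" "reverse n e0 \<in> ring n f e0" unfolding ring_def by blast+
    then show ?thesis using e0(1) reverse_reverse[OF z_verts] by auto
  qed
  ultimately have "{x. ((x, ?r), North) \<in> ring n f e0} = {i + b}" using level by blast
  then have "odd (card {x. ((x, ?r), North) \<in> ring n f e0})" by simp
  moreover have "?r \<in> rows n" using n by (simp add: rows_def)
  ultimately have "closed_ring n b (b + m) f e0"
    unfolding closed_ring_def using e0_streets \<open>\<exists>q>0. _\<close> orbit cols by blast
  then show ?thesis ..
qed

subsection \<open>Toggling random mirrors\<close>

abbreviation coins :: "real \<Rightarrow> vertex set \<Rightarrow> (vertex \<Rightarrow> bool) pmf" where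
  "coins p D \<equiv> Pi_pmf D False (\<lambda>_. bernoulli_pmf p)"

lemma prob_pmf_domination:
  assumes "\<And>x. pmf M x \<le> k * pmf N x" "finite (set_pmf M)" "0 \<le> k"
  shows "measure_pmf.prob M A \<le> k * measure_pmf.prob N A"
proof -
  let ?A = "A \<inter> set_pmf M"
  have "measure_pmf.prob M A = (\<Sum>x\<in>?A. pmf M x)"
    using assms(2) by (simp add: measure_measure_pmf_finite flip: measure_Int_set_pmf[of M A])
  also have "\<dots> \<le> (\<Sum>x\<in>?A. k * pmf N x)" by (intro sum_mono assms)
  also have "\<dots> = k * measure_pmf.prob N ?A"
    using assms(2) by (simp add: measure_measure_pmf_finite sum_distrib_left)
  also have "\<dots> \<le> k * measure_pmf.prob N A"
    using assms(3) by (intro mult_left_mono measure_pmf.finite_measure_mono) auto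
  finally show ?thesis .
qed

lemma finite_coins: "finite D \<Longrightarrow> finite (set_pmf (coins p D))"
  using finite_subset[OF set_Pi_pmf_subset'] finite_PiE_dflt[of D] by (metis comp_apply finite)

lemma toggle_toggle: "toggle v (toggle v f) = f"
  by (auto simp: toggle_def)

text \<open>Only the factor at \<open>v\<close> changes. It is at most 1 after the toggle and at
  least \<open>p * (1 - p)\<close> before it, for either value of the coin.\<close>

lemma pmf_toggle:
  assumes p: "0 < p" "p < 1" and D: "finite D" "v \<in> D"
  shows "pmf (coins p D) (toggle v f) \<le> 1 / (p * (1 - p)) * pmf (coins p D) f"
proof (cases "\<forall>x. x \<notin> D \<longrightarrow> f x = False")
  case True
  have out: "\<And>x. x \<notin> D \<Longrightarrow> f x = False" "\<And>x. x \<notin> D \<Longrightarrow> toggle v f x = False"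
    using True D(2) by (auto simp: toggle_def)
  let ?R = "\<Prod>x\<in>D - {v}. pmf (bernoulli_pmf p) (f x)"
  have R: "(\<Prod>x\<in>D - {v}. pmf (bernoulli_pmf p) (toggle v f x)) = ?R"
    by (intro prod.cong) (auto simp: toggle_def)
  have low: "p * (1 - p) \<le> pmf (bernoulli_pmf p) b" for b
    using p mult_left_le_one_le[of "1 - p" p] mult_right_le_one_le[of p "1 - p"] by (cases b) auto
  have "pmf (coins p D) (toggle v f) = pmf (bernoulli_pmf p) (toggle v f v) * ?R"
    by (subst pmf_Pi'[OF D(1) out(2)]) (simp_all add: prod.remove[OF D] R)
  also have "\<dots> \<le> 1 * ?R"
    by (intro mult_right_mono pmf_le_1 prod_nonneg) auto
  also have "\<dots> \<le> 1 / (p * (1 - p)) * pmf (bernoulli_pmf p) (f v) * ?R"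
    using low[of "f v"] p by (intro mult_right_mono prod_nonneg) (auto simp: field_simps)
  also have "\<dots> = 1 / (p * (1 - p)) * pmf (coins p D) f"
    by (subst pmf_Pi'[OF D(1) out(1)]) (simp_all add: prod.remove[OF D])
  finally show ?thesis .
next
  case False
  then have "\<exists>x. x \<notin> D \<and> toggle v f x \<noteq> False" using D by (auto simp: toggle_def)
  from pmf_Pi_outside[OF D(1) this] p show ?thesis by simp
qed

lemma prob_toggle:
  assumes p: "0 < p" "p < 1" and D: "finite D" "v \<in> D"
  shows "measure_pmf.prob (coins p D) {f. toggle v f \<in> G} \<le> 1 / (p * (1 - p)) * measure_pmf.prob (coins p D) G"
proof -
  have inj: "inj (toggle v)" by (metis injI toggle_toggle)
  have "measure_pmf.prob (coins p D) {f. toggle v f \<in> G} = measure_pmf.prob (map_pmf (toggle v) (coins p D)) G"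
    by (simp add: vimage_def)
  also have "\<dots> \<le> 1 / (p * (1 - p)) * measure_pmf.prob (coins p D) G"
  proof (rule prob_pmf_domination)
    fix g
    have "pmf (map_pmf (toggle v) (coins p D)) g = pmf (coins p D) (toggle v g)"
      using pmf_map_inj'[OF inj, of "coins p D" "toggle v g"] by (simp add: toggle_toggle)
    then show "pmf (map_pmf (toggle v) (coins p D)) g \<le> 1 / (p * (1 - p)) * pmf (coins p D) g"
      using pmf_toggle[OF p D, of g] by simp
  qed (use p finite_coins[OF D(1)] in auto)
  finally show ?thesis .
qed

text \<open>A union bound over the sites: each toggle costs \<open>card B\<close> for the choice and
  \<open>1 / (p * (1 - p))\<close> for the change of law. The factor 3 collects the cases of zero,
  one and two toggles, all bounded by the cost of two.\<close>

lemma prob_two_toggles: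
  assumes p: "0 < p" "p < 1" and B: "finite B" "B \<noteq> {}"
    and E: "\<And>g. g \<in> E \<Longrightarrow> g \<in> G \<or> (\<exists>v\<in>B. toggle v g \<in> G) \<or> (\<exists>v\<in>B. \<exists>w\<in>B. toggle v (toggle w g) \<in> G)"
  shows "measure_pmf.prob (coins p B) E \<le> 3 * (real (card B) / (p * (1 - p)))\<^sup>2 * measure_pmf.prob (coins p B) G"
proof -
  let ?P = "measure_pmf.prob (coins p B)"
  define k where "k = 1 / (p * (1 - p))"
  define N where "N = real (card B)"
  have k: "1 \<le> k" using p mult_le_one[of p "1 - p"] by (simp add: k_def field_simps)
  have N: "1 \<le> N" using B by (simp add: N_def Suc_le_eq card_gt_0_iff)
  have union: "?P (\<Union>v\<in>B. {f. toggle v f \<in> H}) \<le> N * k * ?P H" for H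
  proof -
    have "?P (\<Union>v\<in>B. {f. toggle v f \<in> H}) \<le> (\<Sum>v\<in>B. ?P {f. toggle v f \<in> H})"
      using B(1) by (intro measure_pmf.finite_measure_subadditive_finite) auto
    also have "\<dots> \<le> (\<Sum>v\<in>B. k * ?P H)"
      unfolding k_def by (intro sum_mono prob_toggle p B)
    finally show ?thesis by (simp add: N_def)
  qed
  define G1 where "G1 = (\<Union>v\<in>B. {f. toggle v f \<in> G})"
  define G2 where "G2 = (\<Union>v\<in>B. {f. toggle v f \<in> G1})"
  have "E \<subseteq> G \<union> G1 \<union> G2" using E unfolding G1_def G2_def by blast
  then have "?P E \<le> ?P (G \<union> G1 \<union> G2)" by (intro measure_pmf.finite_measure_mono) auto
  also have "\<dots> \<le> ?P G + ?P G1 + ?P G2"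
    using measure_Un_le[of G "coins p B" G1] measure_Un_le[of "G \<union> G1" "coins p B" G2] by simp
  also have "\<dots> \<le> ?P G + N * k * ?P G + N * k * (N * k * ?P G)"
  proof -
    have "0 \<le> N * k" using N k by simp
    then have "N * k * ?P G1 \<le> N * k * (N * k * ?P G)"
      using union[of G] unfolding G1_def by (rule mult_left_mono[rotated])
    then show ?thesis using union[of G] union[of G1] unfolding G1_def[symmetric] G2_def[symmetric] by linarith
  qed
  also have "\<dots> = (1 + N * k + (N * k)\<^sup>2) * ?P G"
    by (simp add: algebra_simps power2_eq_square)
  also have "\<dots> \<le> 3 * (N * k)\<^sup>2 * ?P G"
  proof (rule mult_right_mono)
    have "1 \<le> N * k" using mult_mono[OF N k] N by simp
    moreover from this have "N * k \<le> (N * k)\<^sup>2" using mult_left_mono[of 1 "N * k" "N * k"] by (simp add: power2_eq_square)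
    ultimately show "1 + N * k + (N * k)\<^sup>2 \<le> 3 * (N * k)\<^sup>2" by linarith
  qed simp
  finally show ?thesis by (simp add: N_def k_def)
qed

section \<open>Probability of a ring and of a drop in one block\<close>

lemma prob_coins_bij:
  assumes "finite R" "inj h"
  shows "measure_pmf.prob (coins p (h ` R)) {f. Q (f \<circ> h)} = measure_pmf.prob (coins p R) {g. Q g}"
proof -
  have "coins p R = map_pmf (\<lambda>g. g \<circ> h) (coins p (h ` R))"
    using assms by (intro Pi_pmf_bij_betw) (auto simp: bij_betw_def inj_def inj_on_def)
  then show ?thesis by (simp add: vimage_def)
qed

lemma prob_pair_pmf_times:
  "measure_pmf.prob (pair_pmf M N) (A \<times> B) = measure_pmf.prob M A * measure_pmf.prob N B"
proof -
  have "(A \<times> B) \<inter> set_pmf (pair_pmf M N) = (A \<inter> set_pmf M) \<times> (B \<inter> set_pmf N)" by auto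
  then have "measure_pmf.prob (pair_pmf M N) (A \<times> B) =
      measure_pmf.prob (pair_pmf M N) ((A \<inter> set_pmf M) \<times> (B \<inter> set_pmf N))"
    by (metis measure_Int_set_pmf)
  also have "\<dots> = measure_pmf.prob M (A \<inter> set_pmf M) * measure_pmf.prob N (B \<inter> set_pmf N)"
    by (intro measure_pmf_prob_product) (auto intro: countable_subset[OF _ countable_set_pmf])
  finally show ?thesis by (simp add: measure_Int_set_pmf)
qed

lemma block_halves:
  "{b<..b + m} \<times> rows n = lower b ` rectangle m (int n) \<union> upper n b ` rectangle m (int n)"
  "lower b ` rectangle m (int n) \<inter> upper n b ` rectangle m (int n) = {}"
proof -
  show "{b<..b + m} \<times> rows n = lower b ` rectangle m (int n) \<union> upper n b ` rectangle m (int n)"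
  proof (intro set_eqI iffI)
    fix v assume v: "v \<in> {b<..b + m} \<times> rows n"
    obtain x y where xy: "v = (x, y)" by (cases v)
    show "v \<in> lower b ` rectangle m (int n) \<union> upper n b ` rectangle m (int n)"
    proof (cases "y < int n")
      case True
      then have "v = lower b (x - b, y + 1)" "(x - b, y + 1) \<in> rectangle m (int n)"
        using v by (auto simp: xy lower_def rectangle_def rows_def)
      then show ?thesis by blast
    next
      case False
      then have "v = upper n b (x - b, 2 * int n - y)" "(x - b, 2 * int n - y) \<in> rectangle m (int n)"
        using v by (auto simp: xy upper_def rectangle_def rows_def)
      then show ?thesis by blast
    qed
  qed (auto simp: lower_def upper_def rectangle_def rows_def)
qed (auto simp: lower_def upper_def rectangle_def)

text \<open>The two halves of the block are disjoint, hence independent, and each carries the law of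
  the rectangle; this gives the square. The map \<open>h\<close> leaves room for the mirrors of
  earlier blocks.\<close>

lemma prob_ring:
  assumes n: "n \<ge> 1" and b: "odd b" and ij: "i \<in> {1..m}" "j \<in> {1..m}"
    and h: "\<And>g v. v \<in> {b<..b + m} \<times> rows n \<Longrightarrow> h g v = g v"
  shows "(measure_pmf.prob (coins p (rectangle m (int n))) {g. cross_from_to i j m (int n) (mirrors g)})\<^sup>2
    \<le> measure_pmf.prob (coins p ({b<..b + m} \<times> rows n)) {g. \<exists>e0. closed_ring n b (b + m) (h g) e0}"
proof -
  let ?R = "rectangle m (int n)"
  let ?Q = "\<lambda>g. cross_from_to i j m (int n) (mirrors g)"
  let ?B1 = "lower b ` ?R" and ?B2 = "upper n b ` ?R"
  let ?B = "{b<..b + m} \<times> rows n"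
  let ?u = "\<lambda>(f, g) x. if x \<in> ?B1 then f x else g x"
  have fin: "finite ?R" by (simp add: rectangle_def)
  have inj: "inj (lower b)" "inj (upper n b)" by (auto simp: inj_def lower_def upper_def prod_eq_iff)
  have "(measure_pmf.prob (coins p ?R) {g. ?Q g})\<^sup>2 =
      measure_pmf.prob (coins p ?B1) {f. ?Q (f \<circ> lower b)} * measure_pmf.prob (coins p ?B2) {f. ?Q (f \<circ> upper n b)}"
    using prob_coins_bij[OF fin inj(1), of p ?Q] prob_coins_bij[OF fin inj(2), of p ?Q]
    by (simp add: power2_eq_square)
  also have "\<dots> = measure_pmf.prob (pair_pmf (coins p ?B1) (coins p ?B2))
      ({f. ?Q (f \<circ> lower b)} \<times> {f. ?Q (f \<circ> upper n b)})"
    by (simp add: prob_pair_pmf_times)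
  also have "\<dots> \<le> measure_pmf.prob (pair_pmf (coins p ?B1) (coins p ?B2))
      (?u -` {g. \<exists>e0. closed_ring n b (b + m) (h g) e0})"
  proof (rule measure_pmf.finite_measure_mono)
    show "{f. ?Q (f \<circ> lower b)} \<times> {f. ?Q (f \<circ> upper n b)}
      \<subseteq> ?u -` {g. \<exists>e0. closed_ring n b (b + m) (h g) e0}"
    proof (intro subsetI, elim SigmaE)
      fix fg f g assume fg: "fg = (f, g)" "f \<in> {f. ?Q (f \<circ> lower b)}" "g \<in> {f. ?Q (f \<circ> upper n b)}"
      have "\<exists>e0. closed_ring n b (b + m) (h (?u fg)) e0"
      proof (rule ring_exists[OF n b ij])
        show "cross_from_to i j m (int n) (mirrors (f \<circ> lower b))" "cross_from_to i j m (int n) (mirrors (g \<circ> upper n b))"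
          using fg by auto
        fix v assume v: "v \<in> ?R"
        then have "lower b v \<in> ?B" "upper n b v \<in> ?B" "upper n b v \<notin> ?B1"
          unfolding block_halves(1) using block_halves(2)[of b m n] by blast+
        then show "(f \<circ> lower b) v = h (?u fg) (lower b v)" "(g \<circ> upper n b) v = h (?u fg) (upper n b v)"
          using v h by (simp_all add: fg)
      qed
      then show "fg \<in> ?u -` {g. \<exists>e0. closed_ring n b (b + m) (h g) e0}" by simp
    qed
  qed simp
  also have "\<dots> = measure_pmf.prob (coins p ?B) {g. \<exists>e0. closed_ring n b (b + m) (h g) e0}"
    unfolding block_halves(1) using fin by (simp add: Pi_pmf_union[OF _ _ block_halves(2)])
  finally show ?thesis .
qed

definition join :: "vertex set \<Rightarrow> (vertex \<Rightarrow> bool) \<Rightarrow> (vertex \<Rightarrow> bool) \<Rightarrow> vertex \<Rightarrow> bool" where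
  "join D f g x = (if x \<in> D then f x else g x)"

lemma join_toggle: "v \<notin> D \<Longrightarrow> toggle v (join D f g) = join D f (toggle v g)"
  by (rule ext) (auto simp: join_def toggle_def)

text \<open>The numerator bounds the probability of a ring from below if \<open>q\<close> is the
  probability of one crossing; the denominator is the cost of two toggles in a block of width
  \<open>m\<close>.\<close>

definition drop_rate :: "real \<Rightarrow> nat \<Rightarrow> int \<Rightarrow> real \<Rightarrow> real" where
  "drop_rate p n m q = q\<^sup>2 / (3 * (real (card ({0<..m} \<times> rows n)) / (p * (1 - p)))\<^sup>2)"

lemma prob_drop:
  assumes p: "0 < p" "p < 1" and n: "n \<ge> 1" and ab: "a \<le> b" and b: "odd b"
    and ij: "i \<in> {1..m}" "j \<in> {1..m}"
    and f: "\<And>v. f v \<Longrightarrow> v \<in> {a<..b} \<times> rows n" and ne: "crossings n a b f \<noteq> {}"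
  shows "drop_rate p n m (measure_pmf.prob (coins p (rectangle m (int n))) {g. cross_from_to i j m (int n) (mirrors g)})
    \<le> measure_pmf.prob (coins p ({b<..b + m} \<times> rows n))
        {g. card (crossings n a (b + m) (join ({a<..b} \<times> rows n) f g)) < card (crossings n a b f)}"
    (is "drop_rate p n m ?q \<le> measure_pmf.prob ?M ?G")
proof -
  let ?D = "{a<..b} \<times> rows n" and ?B = "{b<..b + m} \<times> rows n"
  let ?h = "join ?D f"
  \<comment> \<open>Restriction to the support ensures that \<open>g\<close> has no mirror outside
    the block, so that the extended slab is \<open>supported\<close>.\<close>
  let ?E = "{g. \<exists>e0. closed_ring n b (b + m) (?h g) e0} \<inter> set_pmf ?M"
  have m: "1 \<le> m" using ij by simp
  have fin: "finite ?B" by (simp add: rows_def)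
  have B_ne: "?B \<noteq> {}" using m n by (auto simp: rows_def)
  have cardB: "card ?B = card ({0<..m} \<times> rows n)" by (simp add: card_cartesian_product)
  have disj: "v \<notin> ?D" if "v \<in> ?B" for v using that by auto
  have "?q\<^sup>2 \<le> measure_pmf.prob ?M {g. \<exists>e0. closed_ring n b (b + m) (?h g) e0}"
    by (rule prob_ring[OF n b ij]) (use disj in \<open>simp add: join_def\<close>)
  also have "\<dots> = measure_pmf.prob ?M ?E" by (simp add: measure_Int_set_pmf)
  also have "\<dots> \<le> 3 * (real (card ?B) / (p * (1 - p)))\<^sup>2 * measure_pmf.prob ?M ?G"
  proof (rule prob_two_toggles[OF p fin B_ne])
    fix g assume g: "g \<in> ?E"
    then obtain e0 where ring: "closed_ring n b (b + m) (?h g) e0" by blast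
    have gB: "g v \<Longrightarrow> v \<in> ?B" for v
      using g set_Pi_pmf_subset[OF fin, of False "\<lambda>_. bernoulli_pmf p"] by blast
    have sup: "supported a (b + m) (?h g)"
      unfolding supported_def
    proof (intro allI impI)
      fix v assume "?h g v"
      then have "v \<in> ?D \<or> v \<in> ?B" using f gB by (auto simp: join_def split: if_splits)
      then show "a < fst v \<and> fst v \<le> b + m" using ab m by auto
    qed
    have ext: "crossings n a (b + m) (?h g') \<subseteq> crossings n a b f" if "\<And>v. g' v \<Longrightarrow> v \<in> ?B" for g'
    proof (rule crossings_extend[OF n ab])
      fix v :: vertex assume "fst v \<le> b"
      then show "?h g' v = f v" using f[of v] that[of v] by (auto simp: join_def)
    qed (use m in simp)
    show "g \<in> ?G \<or> (\<exists>v\<in>?B. toggle v g \<in> ?G) \<or> (\<exists>v\<in>?B. \<exists>w\<in>?B. toggle v (toggle w g) \<in> ?G)"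
    proof (cases "crossings n a (b + m) (?h g) = crossings n a b f")
      case False
      then have "crossings n a (b + m) (?h g) \<subset> crossings n a b f" using ext gB by blast
      then show ?thesis using psubset_card_mono[OF finite_crossings] by blast
    next
      case True
      then obtain s0 where s0: "s0 \<in> crossings n a (b + m) (?h g)" using ne by blast
      have bm: "b \<le> b + m" using m by simp
      show ?thesis
      proof (rule crossings_drop[OF n ab bm sup ring s0])
        fix w1 assume w1: "w1 \<in> ?B" "crossings n a (b + m) (toggle w1 (?h g)) \<subset> crossings n a (b + m) (?h g)"
        then have "toggle w1 g \<in> ?G"
          using psubset_card_mono[OF finite_crossings] True join_toggle[OF disj[OF w1(1)]] by simp
        then show ?thesis using w1 by blast
      next
        fix w1 w2 assume w: "w1 \<in> ?B" "w2 \<in> ?B"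
          "crossings n a (b + m) (toggle w2 (toggle w1 (?h g))) \<subset> crossings n a (b + m) (?h g)"
        then have "toggle w2 (toggle w1 g) \<in> ?G"
          using psubset_card_mono[OF finite_crossings] True
            join_toggle[OF disj[OF w(1)]] join_toggle[OF disj[OF w(2)]] by simp
        then show ?thesis using w by blast
      qed
    qed
  qed
  finally have *: "?q\<^sup>2 \<le> 3 * (real (card ({0<..m} \<times> rows n)) / (p * (1 - p)))\<^sup>2 * measure_pmf.prob ?M ?G"
    unfolding cardB .
  have "real (card ({0<..m} \<times> rows n)) > 0" using fin B_ne cardB by (metis card_gt_0_iff of_nat_0_less_iff)
  then have "3 * (real (card ({0<..m} \<times> rows n)) / (p * (1 - p)))\<^sup>2 > 0" using p by simp
  then show ?thesis using * unfolding drop_rate_def by (simp add: divide_le_eq mult.commute)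
qed

subsection \<open>Decay of the number of crossing rays\<close>

text \<open>At least 1 as long as a ray crosses, and at least halved by any decrease of the number
  of crossing rays, including the drop from one ray to none.\<close>

definition weight :: "nat \<Rightarrow> int \<Rightarrow> int \<Rightarrow> (vertex \<Rightarrow> bool) \<Rightarrow> real" where
  "weight n a b f = (if crossings n a b f = {} then 0 else 2 ^ card (crossings n a b f))"

text \<open>The earlier slab \<open>f\<close> is fixed and only the new block is random. The weight
  never increases and is at least halved with probability at least \<open>q\<close>, whence the
  factor \<open>(1 - q) + q / 2\<close>.\<close>

lemma weight_step:
  assumes p: "0 < p" "p < 1" and n: "n \<ge> 1" and ab: "a \<le> b" and b: "odd b"
    and ij: "i \<in> {1..m}" "j \<in> {1..m}"
    and q: "q \<le> drop_rate p n m (measure_pmf.prob (coins p (rectangle m (int n)))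
      {g. cross_from_to i j m (int n) (mirrors g)})"
    and f: "\<And>v. f v \<Longrightarrow> v \<in> {a<..b} \<times> rows n"
  shows "(\<integral>\<^sup>+ g. weight n a (b + m) (join ({a<..b} \<times> rows n) f g) \<partial>coins p ({b<..b + m} \<times> rows n))
    \<le> ennreal (1 - q / 2) * weight n a b f"
proof -
  let ?M = "coins p ({b<..b + m} \<times> rows n)"
  let ?h = "join ({a<..b} \<times> rows n) f"
  let ?K = "card (crossings n a b f)"
  let ?G = "{g. card (crossings n a (b + m) (?h g)) < ?K}"
  have fin: "finite ({b<..b + m} \<times> rows n)" by (simp add: rows_def)
  have ext: "crossings n a (b + m) (?h g) \<subseteq> crossings n a b f" if g: "g \<in> set_pmf ?M" for g
  proof (rule crossings_extend[OF n ab])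
    have gB: "g v \<Longrightarrow> v \<in> {b<..b + m} \<times> rows n" for v
      using g set_Pi_pmf_subset[OF fin, of False "\<lambda>_. bernoulli_pmf p"] by blast
    fix v :: vertex assume "fst v \<le> b"
    then show "?h g v = f v" using f[of v] gB[of v] by (auto simp: join_def)
  qed (use ij in simp)
  show ?thesis
  proof (cases "crossings n a b f = {}")
    case True
    have "(\<integral>\<^sup>+ g. weight n a (b + m) (?h g) \<partial>?M) = (\<integral>\<^sup>+ g. 0 \<partial>?M)"
      using ext True by (intro nn_integral_cong_AE) (auto simp: AE_measure_pmf_iff weight_def)
    then show ?thesis by simp
  next
    case False
    let ?w = "(2 :: real) ^ ?K"
    have drop: "q \<le> measure_pmf.prob ?M ?G"
      using q prob_drop[OF p n ab b ij f False] by simp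
    have "(\<integral>\<^sup>+ g. weight n a (b + m) (?h g) \<partial>?M) \<le> (\<integral>\<^sup>+ g. ennreal (?w * (1 - indicator ?G g / 2)) \<partial>?M)"
    proof (intro nn_integral_mono_AE, unfold AE_measure_pmf_iff, intro ballI ennreal_leI)
      fix g assume g: "g \<in> set_pmf ?M"
      have "card (crossings n a (b + m) (?h g)) \<le> ?K"
        by (intro card_mono finite_crossings ext g)
      then have 1: "(2 :: real) ^ card (crossings n a (b + m) (?h g)) \<le> ?w"
        by (intro power_increasing) auto
      have 2: "(2 :: real) ^ card (crossings n a (b + m) (?h g)) \<le> ?w / 2" if "g \<in> ?G"
        using power_increasing[of "Suc (card (crossings n a (b + m) (?h g)))" ?K "2 :: real"] that by simp
      show "weight n a (b + m) (?h g) \<le> ?w * (1 - indicator ?G g / 2)"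
        using 1 2 by (cases "g \<in> ?G") (auto simp: weight_def)
    qed
    also have "\<dots> = ennreal (measure_pmf.expectation ?M (\<lambda>g. ?w * (1 - indicator ?G g / 2)))"
      by (intro nn_integral_eq_integral measure_pmf.integrable_const_bound[where B = ?w])
        (auto simp: indicator_def)
    also have "measure_pmf.expectation ?M (\<lambda>g. ?w * (1 - indicator ?G g / 2)) = ?w * (1 - measure_pmf.prob ?M ?G / 2)"
    proof -
      have "integrable ?M (\<lambda>g. indicator ?G g / 2 :: real)"
        by (intro measure_pmf.integrable_const_bound[where B = 1]) (auto simp: indicator_def)
      then show ?thesis by (simp add: Bochner_Integration.integral_diff)
    qed
    also have "ennreal \<dots> \<le> ennreal ((1 - q / 2) * ?w)"
      using drop by (intro ennreal_leI) (simp add: mult.commute)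
    also have "\<dots> = ennreal (1 - q / 2) * weight n a b f"
      using False by (simp add: weight_def ennreal_mult'')
    finally show ?thesis .
  qed
qed

lemma weight_decay:
  assumes p: "0 < p" "p < 1" and n: "n \<ge> 1" and a: "odd a" and m: "even m"
    and ij: "i \<in> {1..m}" "j \<in> {1..m}"
    and q: "q \<le> drop_rate p n m (measure_pmf.prob (coins p (rectangle m (int n)))
      {g. cross_from_to i j m (int n) (mirrors g)})"
  shows "(\<integral>\<^sup>+ f. weight n a (a + int t * m) f \<partial>coins p ({a<..a + int t * m} \<times> rows n))
    \<le> ennreal (1 - q / 2) ^ t * 2 ^ n"
proof (induction t)
  case 0
  have "weight n a a f \<le> 2 ^ n" for f
    using power_increasing[OF card_crossings_le[of n a a f], of "2 :: real"] by (simp add: weight_def)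
  then have "ennreal (weight n a a (\<lambda>_. False)) \<le> ennreal (2 ^ n)" by (intro ennreal_leI)
  then show ?case by (simp add: ennreal_power[symmetric])
next
  case (Suc t)
  define b where "b = a + int t * m"
  have m1: "1 \<le> m" using ij by simp
  have ab: "a \<le> b" using m1 by (simp add: b_def)
  \<comment> \<open>Even block width keeps every block boundary odd, as the gluing of the two halves
    requires.\<close>
  have b: "odd b" using a m by (simp add: b_def)
  let ?D = "{a<..b} \<times> rows n" and ?B = "{b<..b + m} \<times> rows n"
  have fin: "finite ?D" "finite ?B" by (simp_all add: rows_def)
  have bm: "a + int (Suc t) * m = b + m" by (simp add: b_def algebra_simps)
  have Un: "{a<..b + m} \<times> rows n = ?D \<union> ?B"
    using ab m1 by auto
  have disj: "?D \<inter> ?B = {}" by auto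
  have "(\<integral>\<^sup>+ f. weight n a (b + m) f \<partial>coins p (?D \<union> ?B)) =
      (\<integral>\<^sup>+ f. \<integral>\<^sup>+ g. weight n a (b + m) (join ?D f g) \<partial>coins p ?B \<partial>coins p ?D)"
    by (simp add: Pi_pmf_union[OF fin disj] nn_integral_map_pmf nn_integral_pair_pmf' join_def[abs_def])
  also have "\<dots> \<le> (\<integral>\<^sup>+ f. ennreal (1 - q / 2) * weight n a b f \<partial>coins p ?D)"
  proof (intro nn_integral_mono_AE, unfold AE_measure_pmf_iff, intro ballI)
    fix f assume "f \<in> set_pmf (coins p ?D)"
    then have "f v \<Longrightarrow> v \<in> ?D" for v
      using set_Pi_pmf_subset[OF fin(1), of False "\<lambda>_. bernoulli_pmf p"] by blast
    then show "(\<integral>\<^sup>+ g. weight n a (b + m) (join ?D f g) \<partial>coins p ?B) \<le> ennreal (1 - q / 2) * weight n a b f"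
      by (rule weight_step[OF p n ab b ij q])
  qed
  also have "\<dots> = ennreal (1 - q / 2) * (\<integral>\<^sup>+ f. weight n a b f \<partial>coins p ?D)"
    by (rule nn_integral_cmult) simp
  also have "\<dots> \<le> ennreal (1 - q / 2) * (ennreal (1 - q / 2) ^ t * 2 ^ n)"
    using Suc.IH unfolding b_def by (rule mult_left_mono) simp
  finally show ?case unfolding bm Un by (simp add: mult.assoc)
qed

lemma prob_crossings:
  assumes p: "0 < p" "p < 1" and n: "n \<ge> 1" and a: "odd a" and m: "even m"
    and ij: "i \<in> {1..m}" "j \<in> {1..m}"
    and q: "q \<le> drop_rate p n m (measure_pmf.prob (coins p (rectangle m (int n)))
      {g. cross_from_to i j m (int n) (mirrors g)})" "q \<le> 2"
  shows "measure_pmf.prob (coins p ({a<..a + int t * m} \<times> rows n)) {f. crossings n a (a + int t * m) f \<noteq> {}}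
    \<le> (1 - q / 2) ^ t * 2 ^ n"
proof -
  let ?M = "coins p ({a<..a + int t * m} \<times> rows n)"
  let ?A = "{f. crossings n a (a + int t * m) f \<noteq> {}}"
  have "ennreal (measure_pmf.prob ?M ?A) = (\<integral>\<^sup>+ f. indicator ?A f \<partial>?M)"
    by (simp add: measure_pmf.emeasure_eq_measure)
  also have "\<dots> \<le> (\<integral>\<^sup>+ f. weight n a (a + int t * m) f \<partial>?M)"
  proof (rule nn_integral_mono)
    fix f
    have "1 \<le> weight n a (a + int t * m) f" if "f \<in> ?A" using that by (simp add: weight_def)
    then show "indicator ?A f \<le> ennreal (weight n a (a + int t * m) f)"
      by (cases "f \<in> ?A") (auto simp: ennreal_1[symmetric] simp del: ennreal_1 intro: ennreal_leI)
  qed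
  also have "\<dots> \<le> ennreal (1 - q / 2) ^ t * 2 ^ n" by (rule weight_decay[OF p n a m ij q(1)])
  also have "\<dots> = ennreal ((1 - q / 2) ^ t * 2 ^ n)"
    using q(2) by (simp add: ennreal_mult ennreal_power[symmetric])
  finally show ?thesis using q(2) by (simp add: ennreal_le_iff)
qed

subsection \<open>From the environment law to finitely many coins\<close>

lemma pmf_site_law: "pmf (site_law Manhattan p v) (mirrors g v) = pmf (bernoulli_pmf p) (g v)"
proof -
  obtain x y where v: "v = (x, y)" by (cases v)
  define h where "h = (\<lambda>mirror. if mirror then (if even (x - y) then NW_Mirror else NE_Mirror) else No_Mirror)"
  have "inj h" by (auto simp: h_def inj_def split: if_splits)
  moreover have "mirrors g v = h (g v)" by (simp add: v mirrors_def h_def)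
  moreover have "site_law Manhattan p v = map_pmf h (bernoulli_pmf p)" by (simp only: v site_law.simps h_def)
  ultimately show ?thesis by (simp add: pmf_map_inj')
qed

text \<open>For each pattern \<open>g\<close> on \<open>J\<close> the environments that agree with
  it on \<open>J\<close> have the probability of \<open>g\<close>, and different patterns give
  disjoint sets. An inequality suffices, so \<open>A\<close> may depend on sites outside
  \<open>J\<close>.\<close>

lemma environment_prob_ge:
  assumes J: "finite J" "J \<subseteq> verts L"
    and A: "A \<in> sets (environment_law Manhattan L p)"
    and Q: "\<And>g \<omega>. g \<in> Q \<Longrightarrow> (\<And>v. g v \<Longrightarrow> v \<in> J) \<Longrightarrow> \<omega> \<in> space (environment_law Manhattan L p) \<Longrightarrow>
      (\<And>v. v \<in> J \<Longrightarrow> \<omega> v = mirrors g v) \<Longrightarrow> \<omega> \<in> A"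
  shows "measure_pmf.prob (coins p J) Q \<le> measure (environment_law Manhattan L p) A"
proof -
  let ?M = "environment_law Manhattan L p"
  interpret product_prob_space "\<lambda>v. measure_pmf (site_law Manhattan p v)" "verts L"
    by unfold_locales
  have M: "?M = PiM (verts L) (\<lambda>v. measure_pmf (site_law Manhattan p v))"
    by (simp add: environment_law_def)
  let ?S = "Q \<inter> PiE_dflt J False (\<lambda>_. UNIV)"
  define Z where "Z g = {\<omega> \<in> space ?M. \<forall>v\<in>J. \<omega> v \<in> {mirrors g v}}" for g
  have fin: "finite ?S" using J(1) by (intro finite_Int disjI2 finite_PiE_dflt) auto
  have Z_prob: "measure ?M (Z g) = pmf (coins p J) g" if "g \<in> ?S" for g
  proof -
    have "emeasure ?M (Z g) = (\<Prod>v\<in>J. emeasure (measure_pmf (site_law Manhattan p v)) {mirrors g v})"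
      unfolding Z_def M by (rule emeasure_PiM_Collect[OF J(2,1)]) simp
    also have "\<dots> = (\<Prod>v\<in>J. ennreal (pmf (bernoulli_pmf p) (g v)))"
      by (simp add: emeasure_pmf_single pmf_site_law)
    also have "\<dots> = ennreal (\<Prod>v\<in>J. pmf (bernoulli_pmf p) (g v))"
      by (simp add: prod_ennreal)
    also have "(\<Prod>v\<in>J. pmf (bernoulli_pmf p) (g v)) = pmf (coins p J) g"
      using that J(1) by (intro pmf_Pi'[symmetric]) (auto simp: PiE_dflt_def)
    finally show ?thesis by (simp add: measure_def)
  qed
  have Z_sets: "Z g \<in> sets ?M" for g
    unfolding Z_def M using J by (intro sets.sets_Collect_finite_All sets_Collect_single') auto
  have Z_disj: "disjoint_family_on Z ?S"
  proof (unfold disjoint_family_on_def, intro ballI impI)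
    fix g g' assume g: "g \<in> ?S" "g' \<in> ?S" "g \<noteq> g'"
    then obtain v where "g v \<noteq> g' v" by blast
    with g have "v \<in> J" by (cases v) (auto simp: PiE_dflt_def)
    have "mirrors g v \<noteq> mirrors g' v" using \<open>g v \<noteq> g' v\<close> by (cases v) (auto simp: mirrors_def)
    then show "Z g \<inter> Z g' = {}" using \<open>v \<in> J\<close> by (auto simp: Z_def)
  qed
  have "measure_pmf.prob (coins p J) Q = measure_pmf.prob (coins p J) ?S"
  proof -
    have "?S \<inter> set_pmf (coins p J) = Q \<inter> set_pmf (coins p J)"
      using set_Pi_pmf_subset[OF J(1), of False "\<lambda>_. bernoulli_pmf p"] by (auto simp: PiE_dflt_def)
    then show ?thesis
      unfolding measure_Int_set_pmf[of "coins p J" Q, symmetric] measure_Int_set_pmf[of "coins p J" ?S, symmetric]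
      by (simp only:)
  qed
  also have "\<dots> = (\<Sum>g\<in>?S. pmf (coins p J) g)" using fin by (rule measure_measure_pmf_finite)
  also have "\<dots> = (\<Sum>g\<in>?S. measure ?M (Z g))" using Z_prob by simp
  also have "\<dots> = measure ?M (\<Union>g\<in>?S. Z g)"
    unfolding M by (rule finite_measure_finite_Union[symmetric]) (use fin Z_sets Z_disj in \<open>auto simp: M\<close>)
  also have "\<dots> \<le> measure ?M A"
    unfolding M
  proof (rule finite_measure_mono)
    show "(\<Union>g\<in>?S. Z g) \<subseteq> A"
    proof (intro UN_least subsetI)
      fix g \<omega> assume g: "g \<in> ?S" and \<omega>: "\<omega> \<in> Z g"
      show "\<omega> \<in> A"
      proof (rule Q[of g])
        show "v \<in> J" if "g v" for v using g that by (cases v) (auto simp: PiE_dflt_def)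
      qed (use g \<omega> in \<open>simp_all add: Z_def\<close>)
    qed
  qed (use A in \<open>simp add: M\<close>)
  finally show ?thesis .
qed

lemma cross_from_to_cong:
  assumes "cross_from_to i j m h \<omega>" "\<And>v. v \<in> rectangle m h \<Longrightarrow> \<omega> v = \<omega>' v"
  shows "cross_from_to i j m h \<omega>'"
proof -
  obtain es where es: "trajectory_segment Plane \<omega> es" "hd es = ((i, 0), North)" "last es = ((j, h), North)"
    and rect: "\<forall>k. 0 < k \<and> k < length es \<longrightarrow> fst (es ! k) \<in> rectangle m h"
    using assms(1) unfolding cross_from_to_def by blast
  have "es ! Suc k = next_edge Plane \<omega>' (es ! k)" if k: "Suc k < length es" for k
  proof -
    have *: "es ! Suc k = next_edge Plane \<omega> (es ! k)" using es(1) k by (simp add: trajectory_segment_def)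
    then have "shift (fst (es ! k)) (snd (es ! k)) \<in> rectangle m h"
      using rect k by (metis fst_conv plane_step zero_less_Suc)
    then show ?thesis using * assms(2) by (simp add: plane_step)
  qed
  then have "trajectory_segment Plane \<omega>' es" using es(1) by (simp add: trajectory_segment_def)
  then show ?thesis unfolding cross_from_to_def using es rect by blast
qed

lemma best_crossing:
  assumes c0: "0 < c0" and m: "1 \<le> m"
    and "c0 \<le> \<P>(\<omega> in environment_law Manhattan Plane p. cross m h \<omega>)"
  obtains i j where "i \<in> {1..m}" "j \<in> {1..m}"
    "c0 / (real_of_int m)\<^sup>2 \<le> measure_pmf.prob (coins p (rectangle m h)) {g. cross_from_to i j m h (mirrors g)}"
proof (rule ccontr)
  assume contra: "\<not> thesis"
  let ?M = "environment_law Manhattan Plane p"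
  let ?R = "rectangle m h"
  let ?X = "{\<omega> \<in> space ?M. cross m h \<omega>}"
  let ?P = "measure_pmf.prob (coins p ?R)"
  interpret prob_space ?M by (rule prob_space_environment_law)
  have fin: "finite ?R" by (simp add: rectangle_def)
  \<comment> \<open>A set that is not measurable has \<open>measure\<close> 0 by convention, so the
    positive lower bound \<open>c0\<close> yields measurability.\<close>
  have X: "?X \<in> sets ?M" using assms measure_notin_sets[of ?X ?M] by fastforce
  \<comment> \<open>The comparison bounds coin probabilities only from above, so it is applied to
    the complement.\<close>
  have "?P {g. \<not> cross m h (mirrors g)} \<le> measure ?M (space ?M - ?X)"
  proof (rule environment_prob_ge[OF fin])
    show "space ?M - ?X \<in> sets ?M" using X by blast
    fix g \<omega> assume g: "g \<in> {g. \<not> cross m h (mirrors g)}" "\<omega> \<in> space ?M"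
      and eq: "\<And>v. v \<in> ?R \<Longrightarrow> \<omega> v = mirrors g v"
    have "\<not> cross m h \<omega>"
      using g(1) cross_from_to_cong[of _ _ m h \<omega> "mirrors g"] eq unfolding cross_def by blast
    then show "\<omega> \<in> space ?M - ?X" using g(2) by simp
  qed simp
  also have "\<dots> = 1 - measure ?M ?X" by (rule prob_compl[OF X])
  also have "\<dots> \<le> 1 - c0" using assms(3) by simp
  finally have "c0 \<le> ?P {g. cross m h (mirrors g)}"
    using measure_pmf.prob_compl[of "{g. cross m h (mirrors g)}" "coins p ?R"]
    by (simp add: Compl_eq_Diff_UNIV[symmetric] Collect_neg_eq)
  also have "{g. cross m h (mirrors g)} = (\<Union>(i, j)\<in>{1..m} \<times> {1..m}. {g. cross_from_to i j m h (mirrors g)})"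
    by (auto simp: cross_def)
  also have "?P \<dots> \<le> (\<Sum>(i, j)\<in>{1..m} \<times> {1..m}. ?P {g. cross_from_to i j m h (mirrors g)})"
    using measure_pmf.finite_measure_subadditive_finite[of "{1..m} \<times> {1..m}"
        "\<lambda>(i, j). {g. cross_from_to i j m h (mirrors g)}" "coins p ?R"]
    by (simp add: case_prod_unfold)
  also have "\<dots> < (\<Sum>(i, j)\<in>{1..m} \<times> {1..m}. c0 / (real_of_int m)\<^sup>2)"
  proof (rule sum_strict_mono)
    show "{1..m} \<times> {1..m} \<noteq> {}" using m by simp
    fix ij assume "ij \<in> {1..m} \<times> {1..m}"
    then show "(case ij of (i, j) \<Rightarrow> ?P {g. cross_from_to i j m h (mirrors g)}) < (case ij of (i, j) \<Rightarrow> c0 / (real_of_int m)\<^sup>2)"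
      using contra that by (cases ij) (auto simp: not_le[symmetric])
  qed simp
  also have "\<dots> = c0" using m by (simp add: case_prod_unfold card_cartesian_product power2_eq_square)
  finally show False by simp
qed

subsection \<open>Blocked slabs\<close>

text \<open>Cuts out one traversal of the slab: \<open>Suc j\<close> is the first time beyond
  \<open>c\<close>, and \<open>i\<close> is the last time up to \<open>j\<close> at or before
  \<open>a\<close>.\<close>

lemma passage_indices:
  fixes x :: "nat \<Rightarrow> int"
  assumes "x 0 \<le> a" "c < x k" "a \<le> c"
  obtains i j where "i \<le> j" "x i \<le> a" "a < x (Suc i)" "x j \<le> c" "c < x (Suc j)"
    "\<And>l. i < l \<Longrightarrow> l \<le> j \<Longrightarrow> a < x l \<and> x l \<le> c"
proof -
  define k0 where "k0 = (LEAST k. c < x k)"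
  have k0: "c < x k0" "\<And>l. l < k0 \<Longrightarrow> x l \<le> c"
  proof -
    show "c < x k0" unfolding k0_def by (rule LeastI) (rule assms(2))
    show "x l \<le> c" if "l < k0" for l
      using not_less_Least[OF that[unfolded k0_def]] by simp
  qed
  have "k0 \<noteq> 0" using k0(1) assms by (intro notI) simp
  then obtain j where j: "k0 = Suc j" by (cases k0) auto
  define i where "i = (GREATEST i. i \<le> j \<and> x i \<le> a)"
  have i: "i \<le> j \<and> x i \<le> a"
    unfolding i_def by (rule GreatestI_nat[of _ 0 j]) (use assms in auto)
  have i_max: "l \<le> i" if "l \<le> j" "x l \<le> a" for l
    unfolding i_def by (rule Greatest_le_nat[of _ _ j]) (use that in auto)
  have inner: "a < x l \<and> x l \<le> c" if "i < l" "l \<le> j" for l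
    using i_max[of l] k0(2)[of l] that j by (auto simp: not_le[symmetric])
  have "a < x (Suc i)"
  proof (cases "i = j")
    case True
    then show ?thesis using k0(1) j assms(3) by simp
  next
    case False
    then show ?thesis using inner[of "Suc i"] i by simp
  qed
  then show thesis using that[of i j] i inner k0 j by simp
qed

lemma oriented_step: "oriented (step n f e) = oriented e"
proof -
  have 1: "oriented (v, paired (mirrors f v) d) \<longleftrightarrow> \<not> oriented (v, d)" for v d
    by (cases v; cases d) (auto simp: mirrors_def)
  have "oriented (head n e, opposite (snd e)) \<longleftrightarrow> \<not> oriented e"
    by (cases e rule: oriented.cases) (auto simp: neighbor_def even_mod_double)
  then show ?thesis by (simp add: step_conv 1)
qed

lemma oriented_path: "oriented ((step n f ^^ k) e) = oriented e"
  by (induction k) (simp_all add: oriented_step del: next_edge.simps)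

lemma step_reverse:
  assumes n: "n \<ge> 1"
  shows "step n f (reverse n (step n f e)) = reverse n e"
proof -
  define w where "w = head n e"
  define d where "d = paired (mirrors f w) (opposite (snd e))"
  have "neighbor (Cylinder n) (neighbor (Cylinder n) w d) (opposite d) = w"
    using neighbor_opposite head_in_verts[OF n] unfolding w_def by blast
  then have "step n f (reverse n (w, d)) = (w, paired (mirrors f w) d)"
    by (simp add: step_conv reverse_def del: next_edge.simps)
  then show ?thesis by (simp add: step_conv[of n f e] reverse_def w_def d_def del: next_edge.simps)
qed

lemma path_reverse:
  assumes n: "n \<ge> 1"
  shows "(step n f ^^ k) (reverse n ((step n f ^^ k) e)) = reverse n e"
proof (induction k)
  case (Suc k)
  have "(step n f ^^ Suc k) (reverse n ((step n f ^^ Suc k) e)) =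
      (step n f ^^ k) (step n f (reverse n (step n f ((step n f ^^ k) e))))"
    by (simp only: funpow_Suc_right funpow.simps(2) o_apply funpow_swap1)
  then show ?case by (simp only: step_reverse[OF n] Suc.IH)
qed simp

text \<open>Outside the slab \<open>\<omega>\<close> is unknown, so only one traversal is
  considered; there the trajectory agrees with the step of \<open>g\<close>. Along the streets it
  would be a ray excluded by \<open>no\<close> or \<open>back_crossing\<close>. Against the streets,
  \<open>path_reverse\<close> turns it into a street ray in the opposite direction, which the other
  of the two facts excludes.\<close>

lemma blocked_slab:
  assumes n: "n \<ge> 1" and ac: "a \<le> c" and g: "\<And>v. g v \<Longrightarrow> v \<in> {a<..c} \<times> rows n"
    and no: "crossings n a c g = {}"
    and \<omega>: "\<And>v. v \<in> {a<..c} \<times> rows n \<Longrightarrow> \<omega> v = mirrors g v"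
    and e: "fst e \<in> verts (Cylinder n)"
  shows "fst (fst e) \<le> a \<Longrightarrow> fst (fst (trajectory (Cylinder n) \<omega> e k)) \<le> c"
    and "c < fst (fst e) \<Longrightarrow> a < fst (fst (trajectory (Cylinder n) \<omega> e k))"
proof -
  let ?N = "next_edge (Cylinder n) \<omega>" and ?F = "step n g"
  define T where "T k = (?N ^^ k) e" for k
  have T_Suc: "T (Suc k) = ?N (T k)" for k by (simp add: T_def)
  have fst_T: "fst (T (Suc k)) = head n (T k)" for k
    unfolding T_Suc by (cases "T k") (simp add: Let_def)
  have T_verts: "fst (T k) \<in> verts (Cylinder n)" for k
    using e head_in_verts[OF n] fst_T by (cases k) (simp_all add: T_def del: next_edge.simps verts.simps)
  have T_rows: "snd (fst (T k)) \<in> rows n" for k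
    using T_verts[of k] by (metis prod.collapse rows_verts)
  have path: "(?F ^^ l) (T i) = T (i + l)" if "\<And>l'. i < l' \<Longrightarrow> l' \<le> i + l \<Longrightarrow> a < fst (fst (T l')) \<and> fst (fst (T l')) \<le> c" for i l
    using that
  proof (induction l)
    case (Suc l)
    have "fst (T (Suc (i + l))) \<in> {a<..c} \<times> rows n"
      using Suc.prems[of "Suc (i + l)"] T_rows by (simp add: mem_Times_iff)
    then have "\<omega> (head n (T (i + l))) = mirrors g (head n (T (i + l)))"
      unfolding fst_T by (rule \<omega>)
    then have "T (Suc (i + l)) = ?F (T (i + l))"
      unfolding T_Suc by (cases "T (i + l)") (simp add: Let_def)
    then show ?case using Suc by simp
  qed simp
  have sup: "supported a c g" unfolding supported_def
  proof (intro allI impI)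
    fix v assume "g v"
    from g[OF this] show "a < fst v \<and> fst v \<le> c" by auto
  qed
  interpret sc: scattering ?F "streets n" "enter_left n a" "enter_right n c"
     "gone_left n a" "gone_right n c" "leave_left n a" "leave_right n c"
    by (rule scattering_slab[OF n ac sup])
  have "sc.crossing = crossings n a c g" by (rule crossings_scattering) (rule sc.scattering_axioms)
  then have no_back: "(?F ^^ l) t \<notin> gone_left n a" if "t \<in> enter_right n c" for t l
    using sc.back_crossing[OF that] no by blast
  have forth: "(?F ^^ l) s \<notin> gone_right n c" if "s \<in> enter_left n a" for s l
    using no that unfolding crossings_def by blast
  have path_verts: "fst ((?F ^^ l) (T i)) \<in> verts (Cylinder n)" for l i
    using T_verts[of i] head_in_verts[OF n] by (cases l) (simp_all del: next_edge.simps verts.simps)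
  have no_way: False if i: "T i = ((a, y), East)" and j: "(?F ^^ l) (T i) = ((c, z), East)" for i l y z
  proof -
    have y: "y \<in> rows n" using T_rows[of i] i by simp
    have z: "z \<in> rows n"
      using path_verts[of l i] unfolding j by (simp add: rows_def)
    have par: "even z = even y" using oriented_path[of l n g "T i"] unfolding j unfolding i by simp
    show False
    proof (cases "even y")
      case True
      then have "T i \<in> enter_left n a" using i y by (simp add: enter_left_def)
      from forth[OF this, of l] show False using j z par True by (auto simp: gone_right_def simp del: next_edge.simps)
    next
      case False
      have "reverse n ((c, z), East) \<in> enter_right n c"
        using False par z by (auto simp: enter_right_def reverse_def neighbor_row)
      from no_back[OF this, of l] path_reverse[OF n, of l g "T i"] show False
        unfolding j unfolding i using False y by (auto simp: gone_left_def reverse_def neighbor_row simp del: next_edge.simps)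
    qed
  qed
  have no_way': False if i: "T i = ((c + 1, y), West)" and j: "(?F ^^ l) (T i) = ((a + 1, z), West)" for i l y z
  proof -
    have y: "y \<in> rows n" using T_rows[of i] i by simp
    have z: "z \<in> rows n"
      using path_verts[of l i] unfolding j by (simp add: rows_def)
    have par: "even z = even y" using oriented_path[of l n g "T i"] unfolding j unfolding i by simp
    show False
    proof (cases "odd y")
      case True
      then have "T i \<in> enter_right n c" using i y by (simp add: enter_right_def)
      from no_back[OF this, of l] show False using j z par True by (auto simp: gone_left_def simp del: next_edge.simps)
    next
      case False
      have "reverse n ((a + 1, z), West) \<in> enter_left n a"
        using False par z by (auto simp: enter_left_def reverse_def neighbor_row)
      from forth[OF this, of l] path_reverse[OF n, of l g "T i"] show False
        unfolding j unfolding i using False y by (auto simp: gone_right_def reverse_def neighbor_row simp del: next_edge.simps)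
    qed
  qed
  have T_eq: "T k = ((fst (fst (T k)), snd (fst (T k))), snd (T k))" for k by simp
  have col: "fst (fst (T (Suc k))) = fst (fst (T k)) + (case snd (T k) of East \<Rightarrow> 1 | West \<Rightarrow> -1 | _ \<Rightarrow> 0)" for k
    unfolding fst_T by (rule head_col)
  show "fst (fst (trajectory (Cylinder n) \<omega> e k)) \<le> c" if start: "fst (fst e) \<le> a"
  proof (rule ccontr)
    assume "\<not> ?thesis"
    then have "c < fst (fst (T k))" by (simp add: T_def trajectory_def)
    moreover have "fst (fst (T 0)) \<le> a" using start by (simp add: T_def)
    ultimately obtain i j where ij: "i \<le> j" "fst (fst (T i)) \<le> a" "a < fst (fst (T (Suc i)))"
      "fst (fst (T j)) \<le> c" "c < fst (fst (T (Suc j)))"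
      and inner: "\<And>l. i < l \<Longrightarrow> l \<le> j \<Longrightarrow> a < fst (fst (T l)) \<and> fst (fst (T l)) \<le> c"
      using passage_indices[of "\<lambda>k. fst (fst (T k))" a c k] ac by blast
    have "snd (T i) = East \<and> fst (fst (T i)) = a"
      using ij(2,3) col[of i] by (cases "snd (T i)") auto
    then have i: "T i = ((a, snd (fst (T i))), East)" using T_eq[of i] by simp
    have "snd (T j) = East \<and> fst (fst (T j)) = c"
      using ij(4,5) col[of j] by (cases "snd (T j)") auto
    then have "T j = ((c, snd (fst (T j))), East)" using T_eq[of j] by simp
    moreover have "(?F ^^ (j - i)) (T i) = T j" using path[of i "j - i"] inner ij(1) by simp
    ultimately show False using no_way[OF i] by metis
  qed
  show "a < fst (fst (trajectory (Cylinder n) \<omega> e k))" if start: "c < fst (fst e)"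
  proof (rule ccontr)
    assume "\<not> ?thesis"
    \<comment> \<open>Negating the columns reduces the leftward passage to
      \<open>passage_indices\<close>; over the integers \<open>x > c\<close> becomes
      \<open>- x \<le> - c - 1\<close>.\<close>
    then have "- a - 1 < - fst (fst (T k))" by (simp add: T_def trajectory_def)
    moreover have "- fst (fst (T 0)) \<le> - c - 1" using start by (simp add: T_def)
    ultimately obtain i j where ij: "i \<le> j" "- fst (fst (T i)) \<le> - c - 1" "- c - 1 < - fst (fst (T (Suc i)))"
      "- fst (fst (T j)) \<le> - a - 1" "- a - 1 < - fst (fst (T (Suc j)))"
      and inner: "\<And>l. i < l \<Longrightarrow> l \<le> j \<Longrightarrow> - c - 1 < - fst (fst (T l)) \<and> - fst (fst (T l)) \<le> - a - 1"
      using passage_indices[of "\<lambda>k. - fst (fst (T k))" "- c - 1" "- a - 1" k] ac by auto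
    have "snd (T i) = West \<and> fst (fst (T i)) = c + 1"
      using ij(2,3) col[of i] by (cases "snd (T i)") auto
    then have i: "T i = ((c + 1, snd (fst (T i))), West)" using T_eq[of i] by simp
    have "snd (T j) = West \<and> fst (fst (T j)) = a + 1"
      using ij(4,5) col[of j] by (cases "snd (T j)") auto
    then have "T j = ((a + 1, snd (fst (T j))), West)" using T_eq[of j] by simp
    moreover have "(?F ^^ (j - i)) (T i) = T j" using path[of i "j - i"] inner ij(1) by fastforce
    ultimately show False using no_way'[OF i] by metis
  qed
qed

subsection \<open>Localization\<close>

lemma measurable_trajectory:
  assumes n: "n \<ge> 1"
  shows "(\<lambda>\<omega>. trajectory (Cylinder n) \<omega> e k) \<in>
    measurable (environment_law D (Cylinder n) p) (count_space UNIV)"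
proof (induction k)
  case (Suc k)
  let ?M = "environment_law D (Cylinder n) p"
  have "countable (UNIV :: dedge set)"
  proof -
    have "countable (UNIV \<times> UNIV :: dedge set)"
      by (intro countable_SIGMA countableI_type countable_finite finite_dir)
    then show ?thesis by simp
  qed
  note countable = this
  have step: "(\<lambda>\<omega>. next_edge (Cylinder n) \<omega> e) \<in> measurable ?M (count_space UNIV)" for e
  proof -
    have "(\<lambda>\<omega>. \<omega> (head n e)) \<in> measurable ?M (measure_pmf (site_law D p (head n e)))"
      unfolding environment_law_def by (rule measurable_component_singleton) (rule head_in_verts[OF n])
    moreover have "(\<lambda>s. (head n e, paired s (opposite (snd e)))) \<in>
        measurable (measure_pmf (site_law D p (head n e))) (count_space UNIV)"
      by simp
    ultimately have "(\<lambda>\<omega>. (head n e, paired (\<omega> (head n e)) (opposite (snd e)))) \<in> measurable ?M (count_space UNIV)"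
      by (rule measurable_compose)
    moreover have "next_edge (Cylinder n) \<omega> e = (head n e, paired (\<omega> (head n e)) (opposite (snd e)))" for \<omega>
      by (cases e) (simp add: Let_def)
    ultimately show ?thesis by simp
  qed
  have "(\<lambda>\<omega>. next_edge (Cylinder n) \<omega> (trajectory (Cylinder n) \<omega> e k)) \<in> measurable ?M (count_space UNIV)"
    by (rule measurable_compose_countable'[OF step Suc countable])
  then show ?case by (simp add: trajectory_def)
qed (simp add: trajectory_def)

lemma sets_trajectory:
  assumes n: "n \<ge> 1" and U: "countable U"
  shows "{\<omega> \<in> space (environment_law D (Cylinder n) p). \<forall>u\<in>U. \<forall>d k. Q (trajectory (Cylinder n) \<omega> (u, d) k)}
    \<in> sets (environment_law D (Cylinder n) p)" (is "?A \<in> sets ?M")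
proof -
  have *: "{\<omega> \<in> space ?M. Q (trajectory (Cylinder n) \<omega> e k)} \<in> sets ?M" for e k
    using measurable_sets[OF measurable_trajectory[OF n, of e k D p], of "Collect Q"]
    by (simp add: vimage_def Int_def conj_commute)
  have d: "countable (UNIV :: dir set)" by (intro countable_finite finite_dir)
  have "{\<omega> \<in> space ?M. \<forall>u\<in>U. \<forall>d\<in>UNIV. \<forall>k\<in>UNIV. Q (trajectory (Cylinder n) \<omega> (u, d) k)} \<in> sets ?M"
    by (intro sets.sets_Collect_countable_All' U d countableI_type *)
  then show ?thesis by simp
qed

text \<open>The two alternatives for \<open>Q\<close> place the blocking slab to the right or to the
  left of column 0, and \<open>Q\<close> holds on the slab and on the side of the start.\<close>

lemma prob_stay:
  assumes p: "0 < p" "p < 1" and n: "n \<ge> 1" and a: "odd a" and m: "even m"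
    and ij: "i \<in> {1..m}" "j \<in> {1..m}"
    and q: "q \<le> drop_rate p n m (measure_pmf.prob (coins p (rectangle m (int n)))
      {g. cross_from_to i j m (int n) (mirrors g)})" "q \<le> 2"
    and Q: "(\<forall>x. x \<le> a + int t * m \<longrightarrow> Q x) \<and> 0 \<le> a \<or> (\<forall>x. a < x \<longrightarrow> Q x) \<and> a + int t * m < 0"
  shows "1 - (1 - q / 2) ^ t * 2 ^ n \<le> measure (environment_law Manhattan (Cylinder n) p)
    {\<omega> \<in> space (environment_law Manhattan (Cylinder n) p).
      \<forall>u\<in>{0} \<times> {0..<2 * int n}. \<forall>d k. Q (fst (fst (trajectory (Cylinder n) \<omega> (u, d) k)))}"
    (is "_ \<le> measure ?M ?A")
proof -
  let ?c = "a + int t * m"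
  let ?J = "{a<..?c} \<times> rows n"
  have ac: "a \<le> ?c" using ij by simp
  have "1 - (1 - q / 2) ^ t * 2 ^ n \<le> 1 - measure_pmf.prob (coins p ?J) {f. crossings n a ?c f \<noteq> {}}"
    using prob_crossings[OF p n a m ij q, of t] by simp
  also have "\<dots> = measure_pmf.prob (coins p ?J) {f. crossings n a ?c f = {}}"
    using measure_pmf.prob_compl[of "{f. crossings n a ?c f \<noteq> {}}" "coins p ?J"]
    by (simp add: Compl_eq_Diff_UNIV[symmetric] Collect_neg_eq[symmetric])
  also have "\<dots> \<le> measure ?M ?A"
  proof (rule environment_prob_ge)
    show "finite ?J" by (simp add: rows_def)
    show "?J \<subseteq> verts (Cylinder n)" by (auto simp: rows_def)
    show "?A \<in> sets ?M"
      by (rule sets_trajectory[OF n, where Q = "\<lambda>e. Q (fst (fst e))"]) simp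
    fix g \<omega> assume g: "g \<in> {f. crossings n a ?c f = {}}" "\<And>v. g v \<Longrightarrow> v \<in> ?J"
      and \<omega>: "\<omega> \<in> space ?M" "\<And>v. v \<in> ?J \<Longrightarrow> \<omega> v = mirrors g v"
    have "Q (fst (fst (trajectory (Cylinder n) \<omega> (u, d) k)))" if u: "u \<in> {0} \<times> {0..<2 * int n}" for u d k
    proof -
      have v: "fst (u, d) \<in> verts (Cylinder n)" "fst (fst (u, d)) = 0" using u by auto
      have no: "crossings n a ?c g = {}" using g(1) by simp
      note b = blocked_slab[OF n ac g(2) no \<omega>(2) v(1), of k]
      from Q show ?thesis
      proof
        assume "(\<forall>x. x \<le> ?c \<longrightarrow> Q x) \<and> 0 \<le> a"
        then show ?thesis using b(1) v(2) by simp
      next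
        assume "(\<forall>x. a < x \<longrightarrow> Q x) \<and> ?c < 0"
        then show ?thesis using b(2) v(2) by simp
      qed
    qed
    then show "\<omega> \<in> ?A" using \<omega>(1) by blast
  qed
  finally show ?thesis .
qed

lemma prob_localized:
  assumes p: "0 < p" "p < 1" and n: "n \<ge> 1" and m: "even m"
    and ij: "i \<in> {1..m}" "j \<in> {1..m}"
    and q: "q \<le> drop_rate p n m (measure_pmf.prob (coins p (rectangle m (int n)))
      {g. cross_from_to i j m (int n) (mirrors g)})" "q \<le> 2"
    and M: "real_of_int (int t * m + 2) \<le> M"
  shows "1 - 2 * ((1 - q / 2) ^ t * 2 ^ n) \<le>
    \<P>(\<omega> in environment_law Manhattan (Cylinder n) p. localized n M \<omega>)"
proof -
  let ?M = "environment_law Manhattan (Cylinder n) p"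
  interpret prob_space ?M by (rule prob_space_environment_law)
  let ?U = "{0} \<times> {0..<2 * int n}"
  define A where "A Q = {\<omega> \<in> space ?M. \<forall>u\<in>?U. \<forall>d k. Q (fst (fst (trajectory (Cylinder n) \<omega> (u, d) k)))}" for Q
  have sets: "A Q \<in> events" for Q
    unfolding A_def by (rule sets_trajectory[OF n, where Q = "\<lambda>e. Q (fst (fst e))"]) simp
  let ?up = "\<lambda>x. real_of_int x \<le> M" and ?low = "\<lambda>x. - M \<le> real_of_int x"
  have "?up x" if "x \<le> 1 + int t * m" for x
  proof -
    have "real_of_int x \<le> real_of_int (int t * m + 2)" using that unfolding of_int_le_iff by simp
    then show ?thesis using M by linarith
  qed
  then have "(\<forall>x. x \<le> 1 + int t * m \<longrightarrow> ?up x) \<and> (0 :: int) \<le> 1 \<or>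
      (\<forall>x. (1 :: int) < x \<longrightarrow> ?up x) \<and> 1 + int t * m < 0"
    by simp
  from prob_stay[OF p n _ m ij q this] have up: "1 - (1 - q / 2) ^ t * 2 ^ n \<le> prob (A ?up)"
    unfolding A_def by simp
  \<comment> \<open>An odd boundary for which the slab ends in column -3, left of the start.
    Trajectories then stay at or right of \<open>- (t * m) - 2\<close>, the source of the summand 2
    in the bound on \<open>M\<close>.\<close>
  let ?a = "- (int t * m) - 3"
  have "?low x" if "?a < x" for x
  proof -
    have "real_of_int (- (int t * m + 2)) \<le> real_of_int x" using that unfolding of_int_le_iff by simp
    then show ?thesis using M by simp
  qed
  then have "(\<forall>x. x \<le> ?a + int t * m \<longrightarrow> ?low x) \<and> 0 \<le> ?a \<or>
      (\<forall>x. ?a < x \<longrightarrow> ?low x) \<and> ?a + int t * m < 0"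
    by simp
  from prob_stay[OF p n _ m ij q this] have low: "1 - (1 - q / 2) ^ t * 2 ^ n \<le> prob (A ?low)"
    unfolding A_def using m by simp
  have "{\<omega> \<in> space ?M. localized n M \<omega>} = A ?up \<inter> A ?low"
  proof -
    have row: "snd (fst (trajectory (Cylinder n) \<omega> (u, d) k)) \<in> {0..<2 * int n}" if u: "u \<in> ?U" for u d k \<omega>
    proof (cases k)
      case 0
      then show ?thesis using u by (auto simp: trajectory_def)
    next
      case (Suc k')
      have "fst (next_edge (Cylinder n) \<omega> e) \<in> verts (Cylinder n)" for e
        using head_in_verts[OF n, of e] by (cases e) (simp add: Let_def)
      from this[of "trajectory (Cylinder n) \<omega> (u, d) k'"] show ?thesis
        by (auto simp: Suc trajectory_def)
    qed
    show ?thesis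
      unfolding localized_def all_remain_in_def remains_in_def A_def mem_Times_iff
      using row by (auto simp: mem_Times_iff)
  qed
  then have "prob {\<omega> \<in> space ?M. localized n M \<omega>} = prob (A ?up \<inter> A ?low)" by simp
  moreover have "prob (A ?up \<union> A ?low) \<le> 1" by (rule prob_le_1)
  moreover have "prob (A ?up \<union> A ?low) = prob (A ?up) + prob (A ?low) - prob (A ?up \<inter> A ?low)"
    using measure_Un3[of "A ?up" ?M "A ?low"] sets by (simp add: fmeasurable_def emeasure_eq_measure)
  ultimately show ?thesis using up low by simp
qed

lemma card_block: "card ({0<..100 * int n} \<times> rows n) = 200 * n\<^sup>2"
  by (simp add: card_cartesian_product rows_def power2_eq_square nat_mult_distrib)

text \<open>The constant is \<open>100 ^ 4 * 3 * 200 ^ 2\<close>: the first factor is the squared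
  number of pairs of columns, and 200 comes from the number of sites of a block.\<close>

lemma drop_rate_ge:
  assumes n: "n \<ge> 1" and p: "0 < p" "p < 1" and c0: "0 < c0"
    and q: "c0 / (real_of_int (100 * int n))\<^sup>2 \<le> q"
  shows "(c0 * p * (1 - p))\<^sup>2 / (12 * 10 ^ 12) / real n ^ 8 \<le> drop_rate p n (100 * int n) q"
proof -
  have "(c0 * p * (1 - p))\<^sup>2 / (12 * 10 ^ 12) / real n ^ 8 =
      (c0 / (real_of_int (100 * int n))\<^sup>2)\<^sup>2 / (3 * (200 * (real n)\<^sup>2 / (p * (1 - p)))\<^sup>2)"
    using n p by (simp add: field_simps power2_eq_square eval_nat_numeral)
  also have "\<dots> \<le> q\<^sup>2 / (3 * (200 * (real n)\<^sup>2 / (p * (1 - p)))\<^sup>2)"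
    using q c0 by (intro divide_right_mono power_mono) auto
  finally show ?thesis by (simp add: drop_rate_def card_block)
qed

theorem theorem1p2:
  fixes c0 p :: real
  assumes "admissible c0" and "0 < p" and "p < 1"
  shows "\<exists>C > (0::real). \<exists>nstar :: nat. \<forall>n :: nat.
           1 \<le> n \<and> nstar \<le> n \<and>
           \<P>(\<omega> in environment_law Manhattan Plane p. cross (100 * int n) (int n) \<omega>) \<ge> c0 \<longrightarrow>
           (\<forall>M :: real. M \<ge> C * real n ^ 10 \<longrightarrow>
              \<P>(\<omega> in environment_law Manhattan (Cylinder n) p. localized n M \<omega>)
                \<ge> 1 - C * exp (- (M / (C * real n ^ 10))))"
proof -
  have c0: "0 < c0" using assms(1) by (simp add: admissible_def)
  \<comment> \<open>The minimum with 1 keeps the rate \<open>q\<close> at most 1.\<close>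
  define \<kappa> where "\<kappa> = min 1 ((c0 * p * (1 - p))\<^sup>2 / (12 * 10 ^ 12))"
  have \<kappa>: "0 < \<kappa>" "\<kappa> \<le> 1" using c0 assms by (auto simp: \<kappa>_def)
  \<comment> \<open>With this value the exponent \<open>q / 2 * (M / (200 * N))\<close> equals
    \<open>2 * (M / (C * N ^ 9))\<close>. One half absorbs the initial weight, as
    \<open>M \<ge> C * N ^ 10\<close>; the other half gives the claimed decay.\<close>
  define C where "C = 800 / \<kappa>"
  have C: "800 \<le> C" using \<kappa> by (simp add: C_def field_simps)
  have "1 - C * exp (- (M / (C * real n ^ 10))) \<le>
      \<P>(\<omega> in environment_law Manhattan (Cylinder n) p. localized n M \<omega>)"
    if n: "1 \<le> n" and cross: "c0 \<le> \<P>(\<omega> in environment_law Manhattan Plane p. cross (100 * int n) (int n) \<omega>)"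
      and M: "C * real n ^ 10 \<le> M" for n :: nat and M :: real
  proof -
    let ?m = "100 * int n"
    define N where "N = real n"
    have N: "1 \<le> N" using n by (simp add: N_def)
    obtain i j where ij: "i \<in> {1..?m}" "j \<in> {1..?m}"
      and prob: "c0 / (real_of_int ?m)\<^sup>2 \<le>
        measure_pmf.prob (coins p (rectangle ?m (int n))) {g. cross_from_to i j ?m (int n) (mirrors g)}"
      using best_crossing[OF c0 _ cross] n by auto
    define q where "q = \<kappa> / N ^ 8"
    have q1: "q \<le> drop_rate p n ?m (measure_pmf.prob (coins p (rectangle ?m (int n)))
        {g. cross_from_to i j ?m (int n) (mirrors g)})"
    proof -
      have "q \<le> (c0 * p * (1 - p))\<^sup>2 / (12 * 10 ^ 12) / real n ^ 8"
        unfolding q_def N_def by (intro divide_right_mono) (auto simp: \<kappa>_def)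
      then show ?thesis using drop_rate_ge[OF n assms(2,3) c0 prob] by linarith
    qed
    have "1 \<le> N ^ 8" using N by simp
    then have q: "0 \<le> q" "q \<le> 1" using \<kappa> by (auto simp: q_def divide_le_eq)
    have N_pow: "N \<le> N ^ 10" using power_increasing[of 1 10 N] N by simp
    have M_N: "800 * N \<le> M"
    proof -
      have "800 * N \<le> C * N ^ 10" using C N_pow N by (intro mult_mono) auto
      then show ?thesis using M by (simp add: N_def)
    qed
    \<comment> \<open>The largest number of blocks of \<open>100 * n\<close> columns that fits into
      \<open>M - 2\<close>. The bound \<open>800 * N \<le> M\<close> makes the loss by rounding at
      most a factor 2.\<close>
    define t where "t = nat \<lfloor>(M - 2) / (100 * N)\<rfloor>"
    have "0 \<le> (M - 2) / (100 * N)" using M_N N by simp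
    then have t_real: "real t = of_int \<lfloor>(M - 2) / (100 * N)\<rfloor>" by (simp add: t_def)
    have t_up: "real t * (100 * N) + 2 \<le> M"
    proof -
      have "real t \<le> (M - 2) / (100 * N)" unfolding t_real by simp
      then show ?thesis using N by (simp add: le_divide_eq)
    qed
    have t_low: "M / (200 * N) \<le> real t"
    proof -
      have "(M - 2) / (100 * N) - 1 \<le> real t" unfolding t_real by linarith
      moreover have "M / (200 * N) \<le> (M - 2) / (100 * N) - 1"
        using M_N N by (simp add: field_simps)
      ultimately show ?thesis by linarith
    qed
    have loc: "1 - 2 * ((1 - q / 2) ^ t * 2 ^ n) \<le>
        \<P>(\<omega> in environment_law Manhattan (Cylinder n) p. localized n M \<omega>)"
    proof (rule prob_localized[OF assms(2,3) n _ ij q1])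
      show "real_of_int (int t * ?m + 2) \<le> M" using t_up by (simp add: N_def)
    qed (use q in auto)
    have "(1 - q / 2) ^ t \<le> exp (- (q / 2)) ^ t"
      using q exp_ge_add_one_self[of "- (q / 2)"] by (intro power_mono) auto
    also have "\<dots> = exp (- (q / 2 * real t))" by (simp add: exp_of_nat_mult[symmetric] mult.commute)
    finally have decay: "(1 - q / 2) ^ t \<le> exp (- (q / 2 * real t))" .
    have "(2 :: real) ^ n \<le> exp 1 ^ n"
      using exp_ge_add_one_self[of 1] by (intro power_mono) auto
    then have two: "(2 :: real) ^ n \<le> exp N" by (simp add: exp_of_nat_mult[symmetric] N_def)
    have "(1 - q / 2) ^ t * 2 ^ n \<le> exp (- (q / 2 * real t)) * exp N"
      using decay two by (intro mult_mono) auto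
    also have "\<dots> = exp (N - q / 2 * real t)" by (simp add: exp_add[symmetric])
    also have "\<dots> \<le> exp (- (M / (C * N ^ 10)))"
    proof -
      have "q / 2 * (M / (200 * N)) \<le> q / 2 * real t" using t_low q by (intro mult_left_mono) auto
      moreover have "q / 2 * (M / (200 * N)) = 2 * (M / (C * N ^ 9))"
        using N \<kappa> by (simp add: q_def C_def field_simps eval_nat_numeral)
      moreover have "N \<le> M / (C * N ^ 9)"
        using M N C by (simp add: N_def[symmetric] le_divide_eq eval_nat_numeral algebra_simps)
      moreover have "M / (C * N ^ 10) \<le> M / (C * N ^ 9)"
        using M_N N C power_increasing[of 9 10 N] by (intro divide_left_mono mult_left_mono mult_pos_pos) auto
      ultimately have "N - q / 2 * real t \<le> - (M / (C * N ^ 10))" by linarith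
      then show ?thesis by (simp only: exp_le_cancel_iff)
    qed
    finally have "2 * ((1 - q / 2) ^ t * 2 ^ n) \<le> C * exp (- (M / (C * N ^ 10)))"
      using C q by (intro mult_mono) (auto intro!: mult_nonneg_nonneg zero_le_power)
    then show ?thesis using loc by (simp add: N_def)
  qed
  then show ?thesis using C by (intro exI[of _ C] exI[of _ 0]) auto
qed

end
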